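(* Let $\kappa>1$. Let $\Omega\subset S^{n-1}$ be a domain with $|\partial\Omega|=0$, and let $D\subset\mathbb R^n$ be a compact hypersurface with $0\notin\overline D$. Assume: (H3) $\displaystyle\inf_{x\in\overline\Omega,\,P\in\overline D}x\cdot\frac{P}{|P|}\ge\frac1\kappa+\tau$ for some $0<\tau<1-\frac1\kappa$; (H4) $0<r_0<\dfrac{\kappa^2\tau^2}{4(\kappa-1)^2}\,\inf_{P\in D}|P|$ and, with $Q_{r_0}=\{tx:x\in\overline\Omega,\ 0<t\le r_0\}$, for each $m\in S^{n-1}$ and each $X\in Q_{r_0}$ the set $\overline D\cap\{X+tm:t\ge0\}$ contains at most one point. Let $\mu$ be a Radon measure on $\overline D$ and let $f\in L^1(\Omega)$ with $f>0$ a.e. satisfy the energy conservation condition $$\int_\Omega f(x)\,dx=\mu(\overline D).$$ Then, given $X_0\in Q_{r_0}$ with $0<|X_0|<\dfrac{r_0^4}{8\left(\sup_D|P|\right)^3}$, there exists a weak solution of the near field refractor problem (with emitting intensity $f$ and prescribed refracted intensity $\mu$) passing through $X_0$; that is, there is a near field refractor $\mathcal S=\{\rho(x)x:x\in\overline\Omega\}$ with $\mathcal M_{\mathcal S,f}(F)=\mu(F)$ for every Borel set $F\subset\overline D$ and $X_0\in\mathcal S$.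
   Context: $n\ge2$; $S^{n-1}$ is the unit sphere in $\mathbb R^n$, $|\cdot|$ of subsets of the sphere and $dx$ refer to surface measure on the sphere. $\kappa=n_2/n_1$ is the ratio of the refractive indices. For $P\in\mathbb R^n$ and $|P|<b<\kappa|P|$, let $$I(P,b)=\frac{b+\sqrt{(\kappa^2-1)(\kappa^2|P|^2-b^2)}}{\kappa^2|P|},$$ and for $x\in S^{n-1}$ with $x\cdot\frac{P}{|P|}\ge I(P,b)$ let $$h(x,P,b)=\frac{(\kappa^2x\cdot P-b)-\sqrt{(\kappa^2x\cdot P-b)^2-(\kappa^2-1)(\kappa^2|P|^2-b^2)}}{\kappa^2-1}.$$ The refracting oval is $\mathcal O(P,b)=\{h(x,P,b)x:x\in S^{n-1},\ x\cdot P\ge I(P,b)|P|\}$. A surface $\mathcal S=\{\rho(x)x:x\in\overline\Omega\}\subset Q_{r_0}$ ($\rho>0$) is a near field refractor if for each $y\in\overline\Omega$ there exist $P\in\overline D$ and $b$ such that $\mathcal O(P,b)$ supports $\mathcal S$ at $\rho(y)y$, i.e. $\overline\Omega\subset\{x\in S^{n-1}:x\cdot\frac{P}{|P|}\ge I(P,b)\}$ and $\rho(x)\ge h(x,P,b)$ for all $x\in\overline\Omega$, with equality at $x=y$. The refractor map is $\mathcal R_{\mathcal S}(x)=\{P\in\overline D:\text{ there is a supporting oval }\mathcal O(P,b)\text{ to }\mathcal S\text{ at }\rho(x)x\}$, $x\in\overline\Omega$. For $F\subset\overline D$, $\mathcal R_{\mathcal S}^{-1}(F)=\{x\in\overline\Omega:\mathcal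 R_{\mathcal S}(x)\cap F\neq\emptyset\}$, and $\mathcal M_{\mathcal S,f}(F)=\int_{\mathcal R_{\mathcal S}^{-1}(F)}f\,dx$ (a Radon measure on $\overline D$). A near field refractor $\mathcal S$ is a weak solution of the near field refractor problem for $\kappa>1$ with emitting intensity $f$ on $\overline\Omega$ and prescribed refracted intensity $\mu$ on $\overline D$ if $\mathcal M_{\mathcal S,f}(F)=\mu(F)$ for every Borel $F\subset\overline D$. *)

theory Defs
  imports "HOL-Analysis.Analysis"
begin

text \<open>Surface measure on the unit sphere: the surface measure of a Borel set \<open>A\<close> is \<open>n\<close> times the
  volume of the cone \<open>{t x | x \<in> A, 0 < t \<le> 1}\<close>. The completion is taken because the sets of
  directions refracted into a Borel set are in general only measurable up to null sets.\<close>

definition sphere_measure :: "'a::euclidean_space measure" where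
  "sphere_measure =
     completion (scale_measure (of_nat DIM('a))
       (distr (restrict_space lborel (cball 0 1 - {0})) (restrict_space borel (sphere 0 1))
         (\<lambda>x. x /\<^sub>R norm x)))"

text \<open>Hypersurfaces are embedded topological manifolds of codimension one. A boundary is allowed:
  a compact hypersurface without boundary either surrounds the source or is hit twice by some ray,
  so it cannot serve as a target. The local model is a closed half-space of a hyperplane.\<close>

definition hypersurface :: "'a::euclidean_space set \<Rightarrow> bool" where
  "hypersurface D \<longleftrightarrow> D \<noteq> {} \<and>
     (\<forall>P\<in>D. \<exists>U V (u::'a) w. P \<in> U \<and> openin (top_of_set D) U \<and>
        u \<noteq> 0 \<and> w \<noteq> 0 \<and> u \<bullet> w = 0 \<and>
        openin (top_of_set {v. u \<bullet> v = 0 \<and> 0 \<le> w \<bullet> v}) V \<and> U homeomorphic V)"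

definition radon_measure_on :: "'a::topological_space set \<Rightarrow> 'a measure \<Rightarrow> bool" where
  "radon_measure_on T \<mu> \<longleftrightarrow>
     sets \<mu> = sets (restrict_space borel T) \<and>
     (\<forall>K. compact K \<and> K \<subseteq> T \<longrightarrow> emeasure \<mu> K < \<infinity>) \<and>
     (\<forall>B\<in>sets \<mu>. emeasure \<mu> B = (SUP K\<in>{K. compact K \<and> K \<subseteq> B}. emeasure \<mu> K))"

definition oval_threshold :: "real \<Rightarrow> 'a::euclidean_space \<Rightarrow> real \<Rightarrow> real" where
  "oval_threshold \<kappa> P b =
     (b + sqrt ((\<kappa>\<^sup>2 - 1) * (\<kappa>\<^sup>2 * (norm P)\<^sup>2 - b\<^sup>2))) / (\<kappa>\<^sup>2 * norm P)"

definition oval_radius :: "real \<Rightarrow> 'a::euclidean_space \<Rightarrow> 'a \<Rightarrow> real \<Rightarrow> real" where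
  "oval_radius \<kappa> x P b =
     ((\<kappa>\<^sup>2 * (x \<bullet> P) - b)
        - sqrt ((\<kappa>\<^sup>2 * (x \<bullet> P) - b)\<^sup>2 - (\<kappa>\<^sup>2 - 1) * (\<kappa>\<^sup>2 * (norm P)\<^sup>2 - b\<^sup>2)))
     / (\<kappa>\<^sup>2 - 1)"

definition source_cone :: "'a::euclidean_space set \<Rightarrow> real \<Rightarrow> 'a set" where
  "source_cone \<Omega> r0 = {t *\<^sub>R x | t x. x \<in> closure \<Omega> \<and> 0 < t \<and> t \<le> r0}"

definition radial_surface :: "'a::euclidean_space set \<Rightarrow> ('a \<Rightarrow> real) \<Rightarrow> 'a set" where
  "radial_surface \<Omega> \<rho> = {\<rho> x *\<^sub>R x | x. x \<in> closure \<Omega>}"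

text \<open>The oval with focus \<open>P\<close> and parameter \<open>b\<close> supports the radial surface of \<open>\<rho>\<close> at \<open>\<rho> y *\<^sub>R y\<close>.
  The bounds on \<open>b\<close> are the standing condition under which the oval is defined.\<close>

definition oval_supports ::
    "real \<Rightarrow> 'a::euclidean_space set \<Rightarrow> ('a \<Rightarrow> real) \<Rightarrow> 'a \<Rightarrow> real \<Rightarrow> 'a \<Rightarrow> bool" where
  "oval_supports \<kappa> \<Omega> \<rho> P b y \<longleftrightarrow>
     norm P < b \<and> b < \<kappa> * norm P \<and>
     closure \<Omega> \<subseteq> {x \<in> sphere 0 1. x \<bullet> (P /\<^sub>R norm P) \<ge> oval_threshold \<kappa> P b} \<and>
     (\<forall>x\<in>closure \<Omega>. \<rho> x \<ge> oval_radius \<kappa> x P b) \<and>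
     \<rho> y = oval_radius \<kappa> y P b"

definition near_field_refractor ::
    "real \<Rightarrow> 'a::euclidean_space set \<Rightarrow> 'a set \<Rightarrow> real \<Rightarrow> ('a \<Rightarrow> real) \<Rightarrow> bool" where
  "near_field_refractor \<kappa> \<Omega> D r0 \<rho> \<longleftrightarrow>
     (\<forall>x\<in>closure \<Omega>. 0 < \<rho> x) \<and>
     radial_surface \<Omega> \<rho> \<subseteq> source_cone \<Omega> r0 \<and>
     (\<forall>y\<in>closure \<Omega>. \<exists>P\<in>closure D. \<exists>b. oval_supports \<kappa> \<Omega> \<rho> P b y)"

definition refractor_map ::
    "real \<Rightarrow> 'a::euclidean_space set \<Rightarrow> 'a set \<Rightarrow> ('a \<Rightarrow> real) \<Rightarrow> 'a \<Rightarrow> 'a set" where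
  "refractor_map \<kappa> \<Omega> D \<rho> x = {P \<in> closure D. \<exists>b. oval_supports \<kappa> \<Omega> \<rho> P b x}"

definition refractor_preimage ::
    "real \<Rightarrow> 'a::euclidean_space set \<Rightarrow> 'a set \<Rightarrow> ('a \<Rightarrow> real) \<Rightarrow> 'a set \<Rightarrow> 'a set" where
  "refractor_preimage \<kappa> \<Omega> D \<rho> F = {x \<in> closure \<Omega>. refractor_map \<kappa> \<Omega> D \<rho> x \<inter> F \<noteq> {}}"

definition refractor_measure ::
    "real \<Rightarrow> 'a::euclidean_space set \<Rightarrow> 'a set \<Rightarrow> ('a \<Rightarrow> real) \<Rightarrow> ('a \<Rightarrow> real) \<Rightarrow> 'a set \<Rightarrow> real" where
  "refractor_measure \<kappa> \<Omega> D \<rho> f F =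
     (LINT x:refractor_preimage \<kappa> \<Omega> D \<rho> F|sphere_measure. f x)"

text \<open>Measurability of the preimages is demanded explicitly: a Bochner integral over a
  non-measurable set would be \<open>0\<close> by convention.\<close>

definition weak_solution ::
    "real \<Rightarrow> 'a::euclidean_space set \<Rightarrow> 'a set \<Rightarrow> real \<Rightarrow> ('a \<Rightarrow> real) \<Rightarrow> 'a measure
       \<Rightarrow> ('a \<Rightarrow> real) \<Rightarrow> bool" where
  "weak_solution \<kappa> \<Omega> D r0 f \<mu> \<rho> \<longleftrightarrow>
     near_field_refractor \<kappa> \<Omega> D r0 \<rho> \<and>
     (\<forall>F\<in>sets borel. F \<subseteq> closure D \<longrightarrow>
        refractor_preimage \<kappa> \<Omega> D \<rho> F \<in> sets sphere_measure \<and>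
        ennreal (refractor_measure \<kappa> \<Omega> D \<rho> f F) = emeasure \<mu> F)"

end

theory Submission
  imports Defs "HOL-Complex_Analysis.Great_Picard"
begin

text \<open>
  Put \<open>\<phi>\<^sub>P(X) = |X| + \<kappa> |P - X|\<close>. The oval with focus \<open>P\<close> and parameter \<open>b\<close> is the first sheet of the
  level set \<open>\<phi>\<^sub>P = b\<close> met by rays from the origin, and the angle condition together with the bound on
  \<open>r0\<close> makes \<open>\<phi>\<^sub>P\<close> strictly decreasing along every ray of the source cone up to distance \<open>r0\<close>. Hence a
  surface inside that cone is supported by an oval with focus \<open>P\<close> exactly at the points where
  \<open>\<phi>\<^sub>P\<close> is maximal on the surface (\<open>oval_supports_iff_touches\<close>). All geometry below is phrased with
  \<open>\<phi>\<^sub>P\<close>. The smallness of \<open>X0\<close> says that every oval through \<open>X0\<close> stays within distance \<open>r0\<close>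
  (\<open>optical_path_at_far_end\<close>).

  The refractor map is single valued almost everywhere. Because \<open>\<phi>\<^sub>P\<close> is convex, an oval touching the
  surface at \<open>Y\<close> gives a half-space containing the surface, that is, a linear function lying above the
  gauge \<open>z \<mapsto> |z| / \<rho>(z/|z|)\<close> and agreeing with it on the ray through \<open>Y\<close>. By Snell's law and the
  assumption that a refracted ray meets the target at most once, two targets seen in one direction
  give two different such functions (\<open>gauge_gradient_inj\<close>). The directions in question are therefore
  kinks of the gauge, and kinks form a null set: in a fixed coordinate direction, those with
  a fixed slope and size of kink meet each line at most once, and a bounded set with this property has
  infinitely many disjoint translates in a bounded region (\<open>negligible_two_supergradients\<close>).

  For finitely many targets \<open>P\<^sub>i\<close> consider the lowest surface on which \<open>\<phi>\<close> for \<open>P\<^sub>i\<close> is at most \<open>b\<^sub>i\<close>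
  for all \<open>i\<close>. It passes through \<open>X0\<close> when \<open>b\<^sub>i\<close> is at least the value of \<open>\<phi>\<close> at \<open>X0\<close> for each \<open>i\<close>,
  with equality for some \<open>i\<close>. The energy received by \<open>P\<^sub>i\<close> depends continuously on \<open>b\<close>: it is upper
  semicontinuous because contact is a closed condition, and the energies add up to a constant. The
  prescribed energies are attained by a topological argument (\<open>box_variational_inequality\<close>, from the
  combinatorial lemma behind Brouwer's theorem), which keeps the surface on \<open>X0\<close> throughout
  (\<open>discrete_refractor\<close>).

  A general target measure is approximated by cutting \<open>D\<close> into small pieces. The surfaces are uniformly
  Lipschitz, so a subsequence converges; contact passes to the limit, which gives
  \<open>\<mu>(F) \<le> \<integral>f\<close> over the directions refracted into \<open>F\<close>, first for closed \<open>F\<close> and then, by inner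
  regularity, for Borel \<open>F\<close>. Applied to \<open>F\<close> and to its complement, and combined with equality of
  the total energies, this becomes an equality (\<open>weak_refractor_exists\<close>).
\<close>

section \<open>Refracting ovals as level sets of the optical path\<close>

text \<open>Up to a constant factor, the time light needs from the source at the origin to \<open>X\<close> and on to \<open>P\<close>.\<close>

definition optical_path :: "real \<Rightarrow> 'a::euclidean_space \<Rightarrow> 'a \<Rightarrow> real" where
  "optical_path \<kappa> P X = norm X + \<kappa> * norm (P - X)"

lemma norm_diff_ray_sq:
  assumes "norm x = 1"
  shows "(norm (P - t *\<^sub>R x))\<^sup>2 = (norm P)\<^sup>2 - 2 * t * (x \<bullet> P) + t\<^sup>2"
proof -
  have "x \<bullet> x = 1" using assms by (simp add: dot_square_norm)
  then show ?thesis
    unfolding power2_norm_eq_inner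
    by (simp add: inner_diff_left inner_diff_right inner_commute algebra_simps power2_eq_square)
qed

text \<open>On a ray, the equation \<open>\<phi>\<^sub>P(t x) = b\<close> squares to a quadratic in \<open>t\<close>. The steepness hypothesis says
  that \<open>\<phi>\<^sub>P\<close> decreases along the ray at \<open>t\<close>, which singles out the smaller root, and this root is
  the oval radius. Reality and positivity of the root give the threshold condition.\<close>

lemma oval_radius_optical_path:
  fixes P x :: "'a::euclidean_space"
  assumes \<kappa>: "1 < \<kappa>" and x: "norm x = 1" and t: "0 < t" and P: "P \<noteq> 0"
    and steep: "norm (P - t *\<^sub>R x) < \<kappa> * (x \<bullet> P - t)"
  shows "oval_radius \<kappa> x P (optical_path \<kappa> P (t *\<^sub>R x)) = t"
    and "oval_threshold \<kappa> P (optical_path \<kappa> P (t *\<^sub>R x)) \<le> x \<bullet> (P /\<^sub>R norm P)"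
proof -
  define s where "s = norm (P - t *\<^sub>R x)"
  define b where "b = optical_path \<kappa> P (t *\<^sub>R x)"
  define A where "A = \<kappa>\<^sup>2 * (x \<bullet> P) - b"
  define C where "C = \<kappa>\<^sup>2 * (norm P)\<^sup>2 - b\<^sup>2"
  have k2: "\<kappa>\<^sup>2 - 1 > 0" using \<kappa> by simp
  have b: "b = t + \<kappa> * s" using t x by (simp add: b_def s_def optical_path_def)
  have s2: "s\<^sup>2 = (norm P)\<^sup>2 - 2 * t * (x \<bullet> P) + t\<^sup>2"
    unfolding s_def by (rule norm_diff_ray_sq[OF x])
  \<comment> \<open>The quadratic equation satisfied by \<open>t\<close>, before \<open>s\<close> is eliminated.\<close>
  have "C - 2 * t * A + (\<kappa>\<^sup>2 - 1) * t\<^sup>2 = \<kappa>\<^sup>2 * ((norm P)\<^sup>2 - 2 * t * (x \<bullet> P) + t\<^sup>2 - s\<^sup>2)"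
    unfolding C_def A_def b by (simp add: algebra_simps power2_eq_square)
  then have quad: "C = 2 * t * A - (\<kappa>\<^sup>2 - 1) * t\<^sup>2" using s2 by simp
  have disc: "A\<^sup>2 - (\<kappa>\<^sup>2 - 1) * C = (A - (\<kappa>\<^sup>2 - 1) * t)\<^sup>2"
    unfolding quad by (simp add: algebra_simps power2_eq_square)
  have "A - (\<kappa>\<^sup>2 - 1) * t = \<kappa> * (\<kappa> * (x \<bullet> P - t) - s)"
    unfolding A_def b by (simp add: algebra_simps power2_eq_square)
  also have "\<dots> > 0" using steep \<kappa> unfolding s_def by simp
  finally have pos: "A - (\<kappa>\<^sup>2 - 1) * t > 0" .
  show "oval_radius \<kappa> x P b = t"
    unfolding oval_radius_def A_def[symmetric] C_def[symmetric] disc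
    using pos k2 by simp
  have "A > 0" using pos k2 t by (smt (verit) mult_pos_pos)
  moreover have "(\<kappa>\<^sup>2 - 1) * C \<le> A\<^sup>2" using disc by (smt (verit) zero_le_power2)
  ultimately have "sqrt ((\<kappa>\<^sup>2 - 1) * C) \<le> A" by (intro real_le_lsqrt) auto
  then have "b + sqrt ((\<kappa>\<^sup>2 - 1) * C) \<le> \<kappa>\<^sup>2 * (x \<bullet> P)" by (simp add: A_def)
  then have "(b + sqrt ((\<kappa>\<^sup>2 - 1) * C)) / (\<kappa>\<^sup>2 * norm P) \<le> \<kappa>\<^sup>2 * (x \<bullet> P) / (\<kappa>\<^sup>2 * norm P)"
    by (intro divide_right_mono) auto
  also have "\<dots> = x \<bullet> (P /\<^sub>R norm P)" using \<kappa> by (simp add: divide_inverse)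
  finally show "oval_threshold \<kappa> P b \<le> x \<bullet> (P /\<^sub>R norm P)"
    unfolding oval_threshold_def C_def[symmetric] .
qed

text \<open>Squaring may introduce a spurious solution with \<open>b < t\<close>; the bound on the oval radius excludes it.\<close>

lemma optical_path_oval_radius:
  fixes P x :: "'a::euclidean_space"
  assumes \<kappa>: "1 < \<kappa>" and x: "norm x = 1" and b: "norm P < b" "b < \<kappa> * norm P"
    and thr: "oval_threshold \<kappa> P b \<le> x \<bullet> (P /\<^sub>R norm P)"
    and le: "oval_radius \<kappa> x P b \<le> norm P"
  shows "0 < oval_radius \<kappa> x P b"
    and "optical_path \<kappa> P (oval_radius \<kappa> x P b *\<^sub>R x) = b"
proof -
  define t where "t = oval_radius \<kappa> x P b"
  define A where "A = \<kappa>\<^sup>2 * (x \<bullet> P) - b"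
  define C where "C = \<kappa>\<^sup>2 * (norm P)\<^sup>2 - b\<^sup>2"
  have k2: "\<kappa>\<^sup>2 - 1 > 0" using \<kappa> by simp
  have P0: "norm P > 0" using b \<kappa> by (metis mult_zero_right norm_ge_zero not_less order_less_le)
  have "b\<^sup>2 < (\<kappa> * norm P)\<^sup>2" using b by (smt (verit) norm_ge_zero power_strict_mono zero_less_numeral)
  then have C: "C > 0" by (simp add: C_def power_mult_distrib)
  have "norm P * (b + sqrt ((\<kappa>\<^sup>2 - 1) * C)) \<le> norm P * (\<kappa>\<^sup>2 * (x \<bullet> P))"
    using thr P0 \<kappa> unfolding oval_threshold_def C_def[symmetric] by (simp add: field_simps)
  then have "b + sqrt ((\<kappa>\<^sup>2 - 1) * C) \<le> \<kappa>\<^sup>2 * (x \<bullet> P)"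
    using P0 mult_le_cancel_left_pos by blast
  then have sA: "sqrt ((\<kappa>\<^sup>2 - 1) * C) \<le> A" by (simp add: A_def)
  have "sqrt ((\<kappa>\<^sup>2 - 1) * C) > 0" using k2 C by simp
  then have A: "A > 0" using sA by linarith
  have "(\<kappa>\<^sup>2 - 1) * C \<le> A\<^sup>2" using sA A by (simp add: sqrt_le_D)
  then have d: "A\<^sup>2 - (\<kappa>\<^sup>2 - 1) * C \<ge> 0" by simp
  define S where "S = sqrt (A\<^sup>2 - (\<kappa>\<^sup>2 - 1) * C)"
  have S2: "S\<^sup>2 = A\<^sup>2 - (\<kappa>\<^sup>2 - 1) * C" unfolding S_def using d by simp
  have tS: "(\<kappa>\<^sup>2 - 1) * t = A - S"
    unfolding t_def oval_radius_def A_def[symmetric] C_def[symmetric] S_def[symmetric]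
    using k2 by simp
  have "S\<^sup>2 < A\<^sup>2" using S2 k2 C by simp
  then have "S < A" using A by (simp add: power2_less_imp_less)
  then show t0: "0 < oval_radius \<kappa> x P b" using tS k2 unfolding t_def[symmetric]
    by (metis diff_gt_0_iff_gt zero_less_mult_pos)
  have "(\<kappa>\<^sup>2 - 1) * ((\<kappa>\<^sup>2 - 1) * t\<^sup>2 - 2 * t * A + C) = ((\<kappa>\<^sup>2 - 1) * t - A)\<^sup>2 - (A\<^sup>2 - (\<kappa>\<^sup>2 - 1) * C)"
    by (simp add: algebra_simps power2_eq_square)
  also have "\<dots> = 0" unfolding tS S2[symmetric] by simp
  finally have quad: "(\<kappa>\<^sup>2 - 1) * t\<^sup>2 - 2 * t * A + C = 0" using k2 by simp
  have "(\<kappa> * norm (P - t *\<^sub>R x))\<^sup>2 = \<kappa>\<^sup>2 * ((norm P)\<^sup>2 - 2 * t * (x \<bullet> P) + t\<^sup>2)"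
    unfolding power_mult_distrib norm_diff_ray_sq[OF x] ..
  also have "\<dots> = (b - t)\<^sup>2 + ((\<kappa>\<^sup>2 - 1) * t\<^sup>2 - 2 * t * A + C)"
    unfolding A_def C_def by (simp add: algebra_simps power2_eq_square)
  also have "\<dots> = (b - t)\<^sup>2" using quad by simp
  finally have "(\<kappa> * norm (P - t *\<^sub>R x))\<^sup>2 = (b - t)\<^sup>2" .
  moreover have "b - t \<ge> 0" using le b by (simp add: t_def)
  ultimately have "\<kappa> * norm (P - t *\<^sub>R x) = b - t"
    using \<kappa> by (simp add: power2_eq_iff_nonneg)
  then show "optical_path \<kappa> P (oval_radius \<kappa> x P b *\<^sub>R x) = b"
    using x t0 by (simp add: optical_path_def t_def)
qed

text \<open>The oval with focus \<open>P\<close> through the point in direction \<open>y\<close> lies on the source side of the surface;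
  its parameter is the optical path at that point.\<close>

definition touches :: "real \<Rightarrow> 'a::euclidean_space set \<Rightarrow> ('a \<Rightarrow> real) \<Rightarrow> 'a \<Rightarrow> 'a \<Rightarrow> bool" where
  "touches \<kappa> K \<rho> P y \<longleftrightarrow>
     (\<forall>x\<in>K. optical_path \<kappa> P (\<rho> x *\<^sub>R x) \<le> optical_path \<kappa> P (\<rho> y *\<^sub>R y))"

lemma optical_path_lipschitz:
  assumes "\<kappa> \<ge> 0"
  shows "\<bar>optical_path \<kappa> P X - optical_path \<kappa> P Y\<bar> \<le> (1 + \<kappa>) * norm (X - Y)"
proof -
  have 1: "\<bar>norm X - norm Y\<bar> \<le> norm (X - Y)" by (rule norm_triangle_ineq3)
  have "\<bar>norm (P - X) - norm (P - Y)\<bar> \<le> norm ((P - X) - (P - Y))" by (rule norm_triangle_ineq3)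
  then have "\<bar>norm (P - X) - norm (P - Y)\<bar> \<le> norm (X - Y)" by (simp add: norm_minus_commute)
  then have "\<bar>\<kappa> * norm (P - X) - \<kappa> * norm (P - Y)\<bar> \<le> \<kappa> * norm (X - Y)"
    using assms by (metis abs_mult abs_of_nonneg mult_left_mono right_diff_distrib')
  with 1 show ?thesis unfolding optical_path_def by (simp add: algebra_simps)
qed

lemma optical_path_source [simp]: "optical_path \<kappa> P 0 = \<kappa> * norm P"
  by (simp add: optical_path_def)

lemma continuous_on_optical_path [continuous_intros]:
  assumes "continuous_on S f" "continuous_on S g"
  shows "continuous_on S (\<lambda>x. optical_path \<kappa> (f x) (g x))"
  unfolding optical_path_def by (intro continuous_intros assms)

text \<open>The margin \<open>\<delta>\<close> by which the optical path decreases along rays is uniform. It turns one-sided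
  estimates on optical paths into estimates on radii.\<close>

locale refraction =
  fixes \<kappa> \<delta> r0 :: real and K D :: "'a::euclidean_space set"
  assumes kappa: "1 < \<kappa>" and delta: "0 < \<delta>" and r0: "0 < r0"
    and K: "compact K" "K \<subseteq> sphere 0 1"
    and D: "compact D" "D \<noteq> {}"
    and far: "P \<in> D \<Longrightarrow> r0 < norm P"
    and steep: "\<lbrakk>x \<in> K; P \<in> D; 0 \<le> t; t \<le> r0\<rbrakk> \<Longrightarrow>
      (1 + \<delta>) * norm (P - t *\<^sub>R x) \<le> \<kappa> * (x \<bullet> P - t)"
begin

lemma norm_K [simp]: "x \<in> K \<Longrightarrow> norm x = 1"
  using K(2) by auto

lemma off_target: "\<lbrakk>x \<in> K; P \<in> D; 0 \<le> t; t \<le> r0\<rbrakk> \<Longrightarrow> 0 < norm (P - t *\<^sub>R x)"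
  using far[of P] norm_triangle_ineq2[of P "t *\<^sub>R x"] by (simp del: zero_less_norm_iff)

lemma steep_strict:
  "\<lbrakk>x \<in> K; P \<in> D; 0 \<le> t; t \<le> r0\<rbrakk> \<Longrightarrow> norm (P - t *\<^sub>R x) < \<kappa> * (x \<bullet> P - t)"
  using steep[of x P t] off_target[of x P t] delta
  by (smt (verit) mult_less_cancel_right1)

text \<open>Since \<open>t \<mapsto> |P - t x|\<close> is convex, its values lie above the tangent at \<open>t\<close>. The slope there is at most
  \<open>- (1 + \<delta>) / \<kappa>\<close> by steepness.\<close>

lemma optical_path_decrease:
  assumes x: "x \<in> K" and P: "P \<in> D" and st: "0 \<le> s" "s \<le> t" "t \<le> r0"
  shows "optical_path \<kappa> P (t *\<^sub>R x) + \<delta> * (t - s) \<le> optical_path \<kappa> P (s *\<^sub>R x)"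
proof -
  define n where "n = norm (P - t *\<^sub>R x)"
  have n: "n > 0" using off_target[OF x P] st by (simp add: n_def)
  have xx: "x \<bullet> x = 1" using x by (simp add: dot_square_norm)
  have "(P - s *\<^sub>R x) \<bullet> (P - t *\<^sub>R x) = n\<^sup>2 + (t - s) * (x \<bullet> P - t)"
    unfolding n_def power2_norm_eq_inner using xx
    by (simp add: inner_diff_left inner_diff_right inner_commute algebra_simps)
  then have "n\<^sup>2 + (t - s) * (x \<bullet> P - t) \<le> norm (P - s *\<^sub>R x) * n"
    unfolding n_def by (metis norm_cauchy_schwarz)
  then have 1: "\<kappa> * (n\<^sup>2 + (t - s) * (x \<bullet> P - t)) \<le> \<kappa> * (norm (P - s *\<^sub>R x) * n)"
    using kappa by simp
  have "(t - s) * ((1 + \<delta>) * n) \<le> (t - s) * (\<kappa> * (x \<bullet> P - t))"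
    using steep[OF x P, of t] st unfolding n_def by (intro mult_left_mono) auto
  then have "(\<kappa> * n + (t - s) * (1 + \<delta>)) * n \<le> (\<kappa> * norm (P - s *\<^sub>R x)) * n"
    using 1 by (simp add: algebra_simps power2_eq_square)
  then have "\<kappa> * n + (t - s) * (1 + \<delta>) \<le> \<kappa> * norm (P - s *\<^sub>R x)"
    using n by simp
  then show ?thesis using x st unfolding optical_path_def n_def by (simp add: algebra_simps)
qed

lemma optical_path_strict_antimono:
  assumes "x \<in> K" "P \<in> D" "0 \<le> s" "s < t" "t \<le> r0"
  shows "optical_path \<kappa> P (t *\<^sub>R x) < optical_path \<kappa> P (s *\<^sub>R x)"
  using optical_path_decrease[of x P s t] assms delta by (smt (verit) mult_pos_pos)

lemma optical_path_le_iff: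
  assumes "x \<in> K" "P \<in> D" "0 \<le> s" "s \<le> r0" "0 \<le> t" "t \<le> r0"
  shows "optical_path \<kappa> P (t *\<^sub>R x) \<le> optical_path \<kappa> P (s *\<^sub>R x) \<longleftrightarrow> s \<le> t"
  using optical_path_strict_antimono[of x P s t] optical_path_strict_antimono[of x P t s] assms
  by (smt (verit))

lemma optical_path_range:
  assumes "x \<in> K" "P \<in> D" "0 < t" "t \<le> r0"
  shows "norm P < optical_path \<kappa> P (t *\<^sub>R x)" "optical_path \<kappa> P (t *\<^sub>R x) < \<kappa> * norm P"
proof -
  have "norm P \<le> norm (t *\<^sub>R x) + norm (P - t *\<^sub>R x)"
    by (metis norm_triangle_sub add.commute)
  also have "\<dots> < optical_path \<kappa> P (t *\<^sub>R x)"
    using off_target[of x P t] assms kappa unfolding optical_path_def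
    by (smt (verit) mult_less_cancel_right1)
  finally show "norm P < optical_path \<kappa> P (t *\<^sub>R x)" .
  show "optical_path \<kappa> P (t *\<^sub>R x) < \<kappa> * norm P"
    using optical_path_strict_antimono[of x P 0 t] assms by simp
qed

lemma optical_path_solve:
  assumes x: "x \<in> K" and P: "P \<in> D"
    and b: "optical_path \<kappa> P (r0 *\<^sub>R x) \<le> b" "b < \<kappa> * norm P"
  obtains t where "0 < t" "t \<le> r0" "optical_path \<kappa> P (t *\<^sub>R x) = b"
proof -
  have "continuous_on {0..r0} (\<lambda>t. optical_path \<kappa> P (t *\<^sub>R x))"
    by (intro continuous_intros)
  then obtain t where t: "0 \<le> t" "t \<le> r0" "optical_path \<kappa> P (t *\<^sub>R x) = b"
    using IVT2'[of "\<lambda>t. optical_path \<kappa> P (t *\<^sub>R x)" r0 b 0] b r0 by auto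
  then have "t \<noteq> 0" using b by auto
  then show ?thesis using t by (intro that[of t]) auto
qed

text \<open>The radius \<open>\<rho> x\<close> is at least the oval radius iff the optical path at \<open>\<rho> x\<close> is at most \<open>b\<close>, by
  monotonicity along rays. The point in direction \<open>z\<close> guarantees that an oval touching the surface is
  met by every ray of the cone before distance \<open>r0\<close>, so that the radius and the threshold make sense
  in all directions.\<close>

lemma oval_supports_iff_touches:
  assumes \<rho>: "\<And>x. x \<in> closure \<Omega> \<Longrightarrow> 0 < \<rho> x \<and> \<rho> x \<le> r0" and K_eq: "K = closure \<Omega>"
    and z: "z \<in> K" "\<And>x P. x \<in> K \<Longrightarrow> P \<in> D \<Longrightarrow> optical_path \<kappa> P (r0 *\<^sub>R x) \<le> optical_path \<kappa> P (\<rho> z *\<^sub>R z)"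
    and y: "y \<in> K" and P: "P \<in> D"
  shows "(\<exists>b. oval_supports \<kappa> \<Omega> \<rho> P b y) \<longleftrightarrow> touches \<kappa> K \<rho> P y"
proof
  assume "\<exists>b. oval_supports \<kappa> \<Omega> \<rho> P b y"
  then obtain b where b: "norm P < b" "b < \<kappa> * norm P"
    and thr: "\<And>x. x \<in> K \<Longrightarrow> oval_threshold \<kappa> P b \<le> x \<bullet> (P /\<^sub>R norm P)"
    and ge: "\<And>x. x \<in> K \<Longrightarrow> oval_radius \<kappa> x P b \<le> \<rho> x" and eq: "\<rho> y = oval_radius \<kappa> y P b"
    unfolding oval_supports_def K_eq by auto
  have *: "0 < oval_radius \<kappa> x P b" "optical_path \<kappa> P (oval_radius \<kappa> x P b *\<^sub>R x) = b"
    if "x \<in> K" for x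
    using optical_path_oval_radius[OF kappa _ b thr[OF that]] ge[OF that] \<rho>[of x] far[OF P] that
    by (auto simp: K_eq[symmetric])
  show "touches \<kappa> K \<rho> P y" unfolding touches_def
  proof
    fix x assume x: "x \<in> K"
    have "optical_path \<kappa> P (\<rho> x *\<^sub>R x) \<le> optical_path \<kappa> P (oval_radius \<kappa> x P b *\<^sub>R x)"
      using optical_path_le_iff[OF x P] ge[OF x] *(1)[OF x] \<rho>[of x] x by (simp add: K_eq[symmetric])
    then show "optical_path \<kappa> P (\<rho> x *\<^sub>R x) \<le> optical_path \<kappa> P (\<rho> y *\<^sub>R y)"
      using *(2)[OF x] *(2)[OF y] eq by simp
  qed
next
  assume t: "touches \<kappa> K \<rho> P y"
  define b where "b = optical_path \<kappa> P (\<rho> y *\<^sub>R y)"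
  have \<rho>y: "0 < \<rho> y" "\<rho> y \<le> r0" using \<rho>[of y] y by (auto simp: K_eq[symmetric])
  have b: "norm P < b" "b < \<kappa> * norm P"
    unfolding b_def using optical_path_range[OF y P] \<rho>y by auto
  have le: "optical_path \<kappa> P (\<rho> x *\<^sub>R x) \<le> b" if "x \<in> K" for x
    using t that unfolding touches_def b_def by auto
  have P0: "P \<noteq> 0" using far[OF P] r0 by auto
  have main: "oval_threshold \<kappa> P b \<le> x \<bullet> (P /\<^sub>R norm P) \<and> oval_radius \<kappa> x P b \<le> \<rho> x"
    if x: "x \<in> K" for x
  proof -
    have "optical_path \<kappa> P (r0 *\<^sub>R x) \<le> b" using z(2)[OF x P] le[OF z(1)] by linarith
    then obtain t where t: "0 < t" "t \<le> r0" "optical_path \<kappa> P (t *\<^sub>R x) = b"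
      using optical_path_solve[OF x P _ b(2)] by blast
    have "t \<le> \<rho> x" using optical_path_le_iff[OF x P, of t "\<rho> x"] le[OF x] t \<rho>[of x] x
      by (simp add: K_eq[symmetric])
    then show ?thesis
      using oval_radius_optical_path[OF kappa norm_K[OF x] t(1) P0] steep_strict[OF x P, of t] t
      by simp
  qed
  have "oval_radius \<kappa> y P b = \<rho> y"
    using oval_radius_optical_path(1)[OF kappa norm_K[OF y] \<rho>y(1) P0] steep_strict[OF y P, of "\<rho> y"] \<rho>y
    by (simp add: b_def)
  then have "oval_supports \<kappa> \<Omega> \<rho> P b y"
    unfolding oval_supports_def using b main K(2) by (auto simp: K_eq[symmetric])
  then show "\<exists>b. oval_supports \<kappa> \<Omega> \<rho> P b y" ..
qed

end

section \<open>Concave functions have few kinks\<close>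

text \<open>The translates of a bounded part of \<open>S\<close> by the vectors \<open>e / (k + 1)\<close> are pairwise disjoint, have the
  same measure, and stay in one ball, so this measure is zero.\<close>

lemma negligible_if_lines_meet_once:
  fixes S :: "'a::euclidean_space set"
  assumes S: "S \<in> sets borel" and once: "\<And>x t. x \<in> S \<Longrightarrow> 0 < t \<Longrightarrow> x + t *\<^sub>R e \<notin> S"
  shows "negligible S"
proof -
  have bnd: "negligible (S \<inter> cball 0 n)" for n :: real
  proof -
    define B where "B = S \<inter> cball 0 n"
    define T where "T k = (+) ((1 / real (Suc k)) *\<^sub>R e) ` B" for k :: nat
    define C where "C = cball (0::'a) (n + norm e)"
    have Bl: "B \<in> lmeasurable"
      unfolding B_def using S by (intro bounded_set_imp_lmeasurable) (auto intro: bounded_Int)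
    have Ts: "T k \<in> lmeasurable" for k
      unfolding T_def by (rule measurable_translation[OF Bl])
    have eT: "emeasure lebesgue (T k) = emeasure lebesgue B" for k
      unfolding emeasure_eq_measure2[OF Ts] emeasure_eq_measure2[OF Bl]
      by (simp add: T_def measure_translation)
    have TC: "T k \<subseteq> C" for k
    proof
      fix y assume "y \<in> T k"
      then obtain x where x: "x \<in> B" "y = (1 / real (Suc k)) *\<^sub>R e + x" unfolding T_def by auto
      have "norm y \<le> norm ((1 / real (Suc k)) *\<^sub>R e) + norm x" unfolding x(2) by (rule norm_triangle_ineq)
      also have "\<dots> \<le> norm e + n" using x(1) unfolding B_def
        by (intro add_mono) (auto simp: divide_le_eq mult_le_cancel_left1)
      finally show "y \<in> C" unfolding C_def by (simp add: add.commute)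
    qed
    have disj: "T k \<inter> T l = {}" if "k < l" for k l
    proof (rule ccontr)
      assume "T k \<inter> T l \<noteq> {}"
      then obtain x y where xy: "x \<in> B" "y \<in> B"
        and eq: "(1 / real (Suc k)) *\<^sub>R e + x = (1 / real (Suc l)) *\<^sub>R e + y" unfolding T_def by auto
      define t where "t = 1 / real (Suc k) - 1 / real (Suc l)"
      have "t > 0" unfolding t_def using that by (simp add: frac_less2)
      moreover have "y = x + t *\<^sub>R e" using eq unfolding t_def
        by (simp add: algebra_simps)
      ultimately show False using once[of x t] xy unfolding B_def by auto
    qed
    have dis: "disjoint_family_on T I" for I
      unfolding disjoint_family_on_def
    proof (intro ballI impI)
      fix k l :: nat assume "k \<noteq> l"
      then show "T k \<inter> T l = {}" using disj[of k l] disj[of l k] by (cases "k < l") auto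
    qed
    define a where "a = measure lebesgue B"
    have ea: "emeasure lebesgue B = ennreal a" unfolding a_def
      by (rule emeasure_eq_measure2[OF Bl])
    have ec: "emeasure lebesgue C = ennreal (measure lebesgue C)"
      unfolding C_def
      by (rule emeasure_eq_measure2[OF lmeasurable_cball])
    have "real N * a \<le> measure lebesgue C" for N
    proof -
      have "ennreal (real N * a) = (\<Sum>k<N. emeasure lebesgue (T k))"
        unfolding eT ea by (simp add: ennreal_mult' a_def ennreal_of_nat_eq_real_of_nat)
      also have "\<dots> = emeasure lebesgue (\<Union>k<N. T k)"
        by (rule sum_emeasure) (use Ts dis in auto)
      also have "\<dots> \<le> emeasure lebesgue C" using TC by (intro emeasure_mono) (auto simp: C_def)
      finally show ?thesis unfolding ec by (simp add: a_def)
    qed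
    then have "\<not> 0 < a" using reals_Archimedean3[of a] by (meson not_le)
    then have "a \<le> 0" by simp
    then have "emeasure lebesgue B = 0" using ea by (simp add: ennreal_neg)
    then show ?thesis using Bl unfolding B_def[symmetric]
      by (auto simp: negligible_iff_null_sets null_sets_def fmeasurable_def)
  qed
  have "S = (\<Union>n::nat. S \<inter> cball 0 (real n))" by (auto simp: real_arch_simple)
  moreover have "negligible \<dots>" using bnd by (intro negligible_countable_Union) auto
  ultimately show ?thesis by simp
qed

text \<open>Two distinct supergradients at \<open>z\<close> differ on some basis vector \<open>e\<close>. For a rational slope \<open>s\<close> strictly
  between them, \<open>V\<close> minus the linear function of slope \<open>s\<close> has, along the line through \<open>z\<close> in
  direction \<open>e\<close>, a maximum at \<open>z\<close> with a definite linear drop. A line has at most one such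
  maximum for given \<open>s\<close>, and only countably many choices of slope and size of drop are needed.\<close>

lemma negligible_two_supergradients:
  fixes V :: "'a::euclidean_space \<Rightarrow> real"
  assumes U: "open U" and V: "continuous_on U V"
  shows "negligible {z \<in> U. \<exists>p q. p \<noteq> q \<and> (\<forall>w\<in>U. V w \<le> V z + p \<bullet> (w - z)) \<and>
                                       (\<forall>w\<in>U. V w \<le> V z + q \<bullet> (w - z))}"
    (is "negligible ?Z")
proof -
  define S where "S e s m = {z \<in> U. \<forall>\<tau>. z + \<tau> *\<^sub>R e \<in> U \<longrightarrow>
      V (z + \<tau> *\<^sub>R e) \<le> V z + s * \<tau> - \<bar>\<tau>\<bar> / real (Suc m)}" for e s and m :: nat
  have neg: "negligible (S e s m)" for e s m
  proof (rule negligible_if_lines_meet_once)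
    \<comment> \<open>Measurability: the points violating the condition at a given step \<open>\<tau>\<close> form an open set.\<close>
    have op: "open ((U \<inter> (\<lambda>z. z + \<tau> *\<^sub>R e) -` U) \<inter>
        (\<lambda>z. V (z + \<tau> *\<^sub>R e) - (V z + s * \<tau> - \<bar>\<tau>\<bar> / real (Suc m))) -` {0<..})" (is "open (?A \<tau> \<inter> ?f \<tau> -` _)") for \<tau>
    proof (rule continuous_open_preimage)
      show A: "open (?A \<tau>)"
        by (intro open_Int U open_vimage continuous_intros)
      have "continuous_on (?A \<tau>) (\<lambda>z. V (z + \<tau> *\<^sub>R e))"
        by (rule continuous_on_compose2[OF V]) (auto intro!: continuous_intros)
      moreover have "continuous_on (?A \<tau>) V" by (rule continuous_on_subset[OF V]) auto
      ultimately show "continuous_on (?A \<tau>) (?f \<tau>)" by (intro continuous_intros)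
    qed auto
    have "U - S e s m = (\<Union>\<tau>. ?A \<tau> \<inter> ?f \<tau> -` {0<..})"
      unfolding S_def by (auto simp: not_le)
    then have "open (U - S e s m)" using op by auto
    then have "U - (U - S e s m) \<in> sets borel" using U by (simp add: sets.Diff)
    moreover have "U - (U - S e s m) = S e s m" unfolding S_def by auto
    ultimately show "S e s m \<in> sets borel" by simp
    fix x t assume x: "x \<in> S e s m" and t: "0 < (t::real)"
    show "x + t *\<^sub>R e \<notin> S e s m"
    proof
      assume y: "x + t *\<^sub>R e \<in> S e s m"
      have "V (x + t *\<^sub>R e) \<le> V x + s * t - \<bar>t\<bar> / real (Suc m)"
        using x y unfolding S_def by auto
      moreover have "V ((x + t *\<^sub>R e) + (- t) *\<^sub>R e) \<le> V (x + t *\<^sub>R e) + s * (- t) - \<bar>- t\<bar> / real (Suc m)"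
      proof -
        have "(x + t *\<^sub>R e) + (- t) *\<^sub>R e \<in> U" using x unfolding S_def by simp
        then show ?thesis using y unfolding S_def by blast
      qed
      ultimately have "2 * (t / real (Suc m)) \<le> 0" using t by simp
      then show False using t by (simp add: divide_le_0_iff)
    qed
  qed
  have "?Z \<subseteq> (\<Union>e\<in>Basis. \<Union>s\<in>\<rat>. \<Union>m. S e s m)"
  proof
    fix z assume "z \<in> ?Z"
    then obtain p q where z: "z \<in> U" and pq: "p \<noteq> q"
      and p: "\<And>w. w \<in> U \<Longrightarrow> V w \<le> V z + p \<bullet> (w - z)"
      and q: "\<And>w. w \<in> U \<Longrightarrow> V w \<le> V z + q \<bullet> (w - z)" by auto
    obtain e where e: "e \<in> Basis" "p \<bullet> e \<noteq> q \<bullet> e" using pq euclidean_eqI by blast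
    define l where "l = min (p \<bullet> e) (q \<bullet> e)"
    define u where "u = max (p \<bullet> e) (q \<bullet> e)"
    have lu: "l < u" using e unfolding l_def u_def by auto
    obtain s where s: "s \<in> \<rat>" "l < s" "s < u" using Rats_dense_in_real[OF lu] by auto
    have "0 < min (u - s) (s - l)" using s by simp
    then obtain m :: nat where m: "1 / real (Suc m) < min (u - s) (s - l)"
      using nat_approx_posE by metis
    have "z \<in> S e s m" unfolding S_def
    proof (intro CollectI conjI allI impI z)
      fix \<tau> assume w: "z + \<tau> *\<^sub>R e \<in> U"
      have 1: "V (z + \<tau> *\<^sub>R e) \<le> V z + \<tau> * l" "V (z + \<tau> *\<^sub>R e) \<le> V z + \<tau> * u"
        using p[OF w] q[OF w] unfolding l_def u_def by (auto simp: min_def max_def)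
      have "\<tau> * l \<le> s * \<tau> - \<bar>\<tau>\<bar> / real (Suc m)" if "\<tau> \<ge> 0"
      proof -
        have "\<tau> * (1 / real (Suc m)) \<le> \<tau> * (s - l)" using that m by (intro mult_left_mono) auto
        then show ?thesis using that by (simp add: algebra_simps)
      qed
      moreover have "\<tau> * u \<le> s * \<tau> - \<bar>\<tau>\<bar> / real (Suc m)" if "\<tau> < 0"
      proof -
        have "(- \<tau>) * (1 / real (Suc m)) \<le> (- \<tau>) * (u - s)" using that m by (intro mult_left_mono) auto
        then show ?thesis using that by (simp add: algebra_simps)
      qed
      ultimately show "V (z + \<tau> *\<^sub>R e) \<le> V z + s * \<tau> - \<bar>\<tau>\<bar> / real (Suc m)"
        using 1 by (smt (verit))
    qed
    then show "z \<in> (\<Union>e\<in>Basis. \<Union>s\<in>\<rat>. \<Union>m. S e s m)" using e(1) s(1) by auto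
  qed
  moreover have "negligible (\<Union>e\<in>Basis. \<Union>s\<in>\<rat>. \<Union>m. S e s m)"
  proof -
    have "negligible (\<Union>m. S e s m)" for e s using neg by (intro negligible_countable_Union) auto
    then have "negligible (\<Union>s\<in>\<rat>. \<Union>m. S e s m)" for e
      by (intro negligible_countable_Union) (auto simp: countable_rat)
    then show ?thesis by (intro negligible_Union) auto
  qed
  ultimately show ?thesis by (rule negligible_subset[rotated])
qed

section \<open>Contact sets of refractors\<close>

lemma tendsto_optical_path [tendsto_intros]:
  assumes "(f \<longlongrightarrow> P) F" "(g \<longlongrightarrow> X) F"
  shows "((\<lambda>i. optical_path \<kappa> (f i) (g i)) \<longlongrightarrow> optical_path \<kappa> P X) F"
  unfolding optical_path_def by (intro tendsto_intros assms)

lemma touches_limit: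
  assumes "\<And>n. touches \<kappa> K (\<rho> n) (P n) (y n)" and "P \<longlonglongrightarrow> P'" and "y \<longlonglongrightarrow> y'"
    and "\<And>x. x \<in> K \<Longrightarrow> (\<lambda>n. \<rho> n x) \<longlonglongrightarrow> \<rho>' x" and "(\<lambda>n. \<rho> n (y n)) \<longlonglongrightarrow> \<rho>' y'"
  shows "touches \<kappa> K \<rho>' P' y'"
  unfolding touches_def
proof
  fix x assume x: "x \<in> K"
  show "optical_path \<kappa> P' (\<rho>' x *\<^sub>R x) \<le> optical_path \<kappa> P' (\<rho>' y' *\<^sub>R y')"
  proof (rule LIMSEQ_le)
    show "(\<lambda>n. optical_path \<kappa> (P n) (\<rho> n x *\<^sub>R x)) \<longlonglongrightarrow> optical_path \<kappa> P' (\<rho>' x *\<^sub>R x)"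
      by (intro tendsto_intros assms x)
    show "(\<lambda>n. optical_path \<kappa> (P n) (\<rho> n (y n) *\<^sub>R y n)) \<longlonglongrightarrow> optical_path \<kappa> P' (\<rho>' y' *\<^sub>R y')"
      by (intro tendsto_intros assms)
    show "\<exists>N. \<forall>n\<ge>N. optical_path \<kappa> (P n) (\<rho> n x *\<^sub>R x) \<le> optical_path \<kappa> (P n) (\<rho> n (y n) *\<^sub>R y n)"
      using assms(1) x unfolding touches_def by blast
  qed
qed

text \<open>Snell's law: the normal of the refracting surface, which is parallel to \<open>y - \<kappa> m\<close>, determines the
  refracted direction \<open>m\<close>. Taking norms in \<open>\<kappa> m = c \<kappa> m' + (1 - c) y\<close> gives a quadratic
  equation for \<open>c\<close> with root \<open>1\<close>, whose other root is negative.\<close>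

lemma refraction_direction_unique:
  fixes y m m' :: "'a::euclidean_space"
  assumes \<kappa>: "1 < \<kappa>" and y: "norm y = 1" and m: "norm m = 1" "norm m' = 1"
    and c: "0 < c" and eq: "y - \<kappa> *\<^sub>R m = c *\<^sub>R (y - \<kappa> *\<^sub>R m')"
  shows "m = m'"
proof -
  have yy: "y \<bullet> y = 1" "m \<bullet> m = 1" "m' \<bullet> m' = 1" using y m by (auto simp: dot_square_norm)
  define w where "w = y \<bullet> m'"
  have w: "w \<le> 1" unfolding w_def using norm_cauchy_schwarz[of y m'] y m by simp
  have eq': "\<kappa> *\<^sub>R m = (c * \<kappa>) *\<^sub>R m' + (1 - c) *\<^sub>R y"
    using eq by (simp add: algebra_simps)
  have "\<kappa>\<^sup>2 = (\<kappa> *\<^sub>R m) \<bullet> (\<kappa> *\<^sub>R m)" using yy by (simp add: power2_eq_square)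
  also have "\<dots> = (c * \<kappa>)\<^sup>2 + 2 * (c * \<kappa>) * (1 - c) * w + (1 - c)\<^sup>2"
    unfolding eq' using yy
    by (simp add: w_def inner_add_left inner_add_right inner_commute algebra_simps power2_eq_square)
  finally have "(c - 1) * (c * (\<kappa>\<^sup>2 - 2 * \<kappa> * w + 1) + (\<kappa>\<^sup>2 - 1)) = 0"
    by (simp add: algebra_simps power2_eq_square)
  moreover have "c * (\<kappa>\<^sup>2 - 2 * \<kappa> * w + 1) + (\<kappa>\<^sup>2 - 1) > 0"
  proof -
    have "\<kappa> * w \<le> \<kappa>" using w \<kappa> by simp
    then have "(\<kappa> - 1)\<^sup>2 \<le> \<kappa>\<^sup>2 - 2 * \<kappa> * w + 1" by (simp add: power2_eq_square algebra_simps)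
    then have "0 \<le> \<kappa>\<^sup>2 - 2 * \<kappa> * w + 1" by (smt (verit) zero_le_power2)
    moreover have "\<kappa>\<^sup>2 - 1 > 0" using \<kappa> by simp
    ultimately show ?thesis using c by (smt (verit) mult_nonneg_nonneg)
  qed
  ultimately have "c = 1" by simp
  then show ?thesis using eq' \<kappa> by simp
qed

locale refractor = refraction \<kappa> \<delta> r0 K D
  for \<kappa> \<delta> r0 :: real and K D :: "'a::euclidean_space set" +
  fixes \<rho> :: "'a \<Rightarrow> real"
  assumes radius: "x \<in> K \<Longrightarrow> 0 < \<rho> x \<and> \<rho> x \<le> r0"
    and touched: "y \<in> K \<Longrightarrow> \<exists>P\<in>D. touches \<kappa> K \<rho> P y"
begin

text \<open>If \<open>\<rho> y > \<rho> x\<close>, contact at \<open>y\<close> bounds the optical path at \<open>x\<close> by that at \<open>y\<close>, while moving from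
  radius \<open>\<rho> x\<close> out to \<open>\<rho> y\<close> on the ray through \<open>x\<close> lowers it by at least \<open>\<delta> (\<rho> y - \<rho> x)\<close>. The constant does
  not depend on \<open>\<rho>\<close>, which makes families of refractors equicontinuous.\<close>

lemma radius_lipschitz:
  assumes xy: "x \<in> K" "y \<in> K"
  shows "\<bar>\<rho> x - \<rho> y\<bar> \<le> (1 + \<kappa>) * r0 / \<delta> * norm (x - y)"
proof -
  have "\<rho> y - \<rho> x \<le> (1 + \<kappa>) * r0 / \<delta> * norm (x - y)" if xy: "x \<in> K" "y \<in> K" for x y
  proof (cases "\<rho> x \<le> \<rho> y")
    case True
    obtain P where P: "P \<in> D" "touches \<kappa> K \<rho> P y" using touched[OF xy(2)] by auto
    have "optical_path \<kappa> P (\<rho> y *\<^sub>R x) + \<delta> * (\<rho> y - \<rho> x) \<le> optical_path \<kappa> P (\<rho> x *\<^sub>R x)"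
      using optical_path_decrease[OF xy(1) P(1), of "\<rho> x" "\<rho> y"] radius[OF xy(1)] radius[OF xy(2)] True
      by auto
    also have "\<dots> \<le> optical_path \<kappa> P (\<rho> y *\<^sub>R y)" using P xy unfolding touches_def by auto
    finally have "\<delta> * (\<rho> y - \<rho> x) \<le> \<bar>optical_path \<kappa> P (\<rho> y *\<^sub>R y) - optical_path \<kappa> P (\<rho> y *\<^sub>R x)\<bar>" by simp
    also have "\<dots> \<le> (1 + \<kappa>) * norm (\<rho> y *\<^sub>R y - \<rho> y *\<^sub>R x)"
      using optical_path_lipschitz kappa by (metis le_less less_trans zero_less_one)
    also have "norm (\<rho> y *\<^sub>R y - \<rho> y *\<^sub>R x) = \<rho> y * norm (x - y)"
      using radius[OF xy(2)] by (simp add: norm_minus_commute flip: scaleR_diff_right)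
    also have "(1 + \<kappa>) * (\<rho> y * norm (x - y)) \<le> (1 + \<kappa>) * (r0 * norm (x - y))"
      using radius[OF xy(2)] kappa by (intro mult_left_mono mult_right_mono) auto
    finally show ?thesis using delta by (simp add: field_simps)
  next
    case False
    then show ?thesis using kappa r0 delta
      by (smt (verit) divide_nonneg_nonneg mult_nonneg_nonneg norm_ge_zero)
  qed
  from this[OF xy] this[OF xy(2,1)] show ?thesis by (simp add: abs_le_iff norm_minus_commute)
qed

lemma continuous_radius: "continuous_on K \<rho>"
proof -
  have "((1 + \<kappa>) * r0 / \<delta>)-lipschitz_on K \<rho>"
  proof (rule lipschitz_onI)
    show "dist (\<rho> x) (\<rho> y) \<le> (1 + \<kappa>) * r0 / \<delta> * dist x y" if "x \<in> K" "y \<in> K" for x y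
      unfolding dist_norm real_norm_def using that by (rule radius_lipschitz)
  qed (use kappa r0 delta in simp)
  then show ?thesis by (rule lipschitz_on_continuous_on)
qed

definition preimage :: "'a set \<Rightarrow> 'a set" where
  "preimage F = {y \<in> K. \<exists>P\<in>D. P \<in> F \<and> touches \<kappa> K \<rho> P y}"

definition ambiguous :: "'a set" where
  "ambiguous = {y \<in> K. \<exists>P\<in>D. \<exists>P'\<in>D. P \<noteq> P' \<and> touches \<kappa> K \<rho> P y \<and> touches \<kappa> K \<rho> P' y}"

lemma compact_touching:
  "compact {(y, P). y \<in> K \<and> P \<in> D \<and> touches \<kappa> K \<rho> P y}" (is "compact ?G")
proof -
  have "closed ?G" unfolding closed_sequential_limits
  proof (intro allI impI)
    fix g l assume g: "(\<forall>n. g n \<in> ?G) \<and> g \<longlonglongrightarrow> l"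
    define y where "y = fst \<circ> g"
    define P where "P = snd \<circ> g"
    have g1: "y n \<in> K" "P n \<in> D" "touches \<kappa> K \<rho> (P n) (y n)" for n
      using g unfolding y_def P_def by (auto simp: split_beta)
    have lim: "y \<longlonglongrightarrow> fst l" "P \<longlonglongrightarrow> snd l" unfolding y_def P_def o_def
      using g by (auto intro: tendsto_fst tendsto_snd)
    have l: "fst l \<in> K" "snd l \<in> D"
      using closed_sequentially[OF compact_imp_closed[OF K(1)] _ lim(1)] g1
        closed_sequentially[OF compact_imp_closed[OF D(1)] _ lim(2)] by auto
    have "(\<lambda>n. \<rho> (y n)) \<longlonglongrightarrow> \<rho> (fst l)"
      by (rule continuous_on_tendsto_compose[OF continuous_radius lim(1) l(1)]) (simp add: g1(1))
    then have "touches \<kappa> K \<rho> (snd l) (fst l)"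
      by (rule touches_limit[of \<kappa> K "\<lambda>n. \<rho>" P y, OF g1(3) lim(2,1) tendsto_const])
    then show "l \<in> ?G" using l by (auto simp: split_beta)
  qed
  then have "compact ((K \<times> D) \<inter> ?G)"
    by (rule compact_Int_closed[OF compact_Times[OF K(1) D(1)]])
  moreover have "(K \<times> D) \<inter> ?G = ?G" by auto
  ultimately show ?thesis by simp
qed

lemma compact_preimage:
  assumes "closed F"
  shows "compact (preimage F)"
proof -
  have "preimage F = fst ` ({(y, P). y \<in> K \<and> P \<in> D \<and> touches \<kappa> K \<rho> P y} \<inter> UNIV \<times> F)"
    unfolding preimage_def by force
  moreover have "compact \<dots>"
    by (intro compact_continuous_image continuous_intros compact_Int_closed compact_touching
        closed_Times assms)
  ultimately show ?thesis by simp
qed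

text \<open>Compactness of the contact relation shows that the directions with two targets at distance at
  least \<open>1 / (m + 1)\<close> form a compact set.\<close>

lemma ambiguous_borel: "ambiguous \<in> sets borel"
proof -
  let ?G = "{(y, P). y \<in> K \<and> P \<in> D \<and> touches \<kappa> K \<rho> P y}"
  define H where "H m = (\<lambda>g. fst (fst g)) ` ((?G \<times> ?G) \<inter>
      {g. fst (fst g) = fst (snd g) \<and> 1 / real (Suc m) \<le> dist (snd (fst g)) (snd (snd g))})" for m
  have "compact (H m)" for m unfolding H_def
    by (intro compact_continuous_image continuous_intros compact_Int_closed compact_Times
        compact_touching closed_Collect_conj closed_Collect_eq closed_Collect_le)
  then have "(\<Union>m. H m) \<in> sets borel" by (auto intro: borel_compact)
  moreover have "ambiguous = (\<Union>m. H m)"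
  proof (intro equalityI subsetI)
    fix y assume "y \<in> ambiguous"
    then obtain P P' where *: "y \<in> K" "P \<in> D" "P' \<in> D" "P \<noteq> P'" "touches \<kappa> K \<rho> P y" "touches \<kappa> K \<rho> P' y"
      unfolding ambiguous_def by auto
    obtain m :: nat where "1 / real (Suc m) < dist P P'"
      using nat_approx_posE[of "dist P P'"] * by auto
    then have "y \<in> H m" unfolding H_def using *
      by (intro image_eqI[of _ _ "((y, P), (y, P'))"]) auto
    then show "y \<in> (\<Union>m. H m)" by auto
  next
    fix y assume "y \<in> (\<Union>m. H m)"
    then obtain m P P' where "y \<in> K" "P \<in> D" "P' \<in> D" "touches \<kappa> K \<rho> P y" "touches \<kappa> K \<rho> P' y"
      "1 / real (Suc m) \<le> dist P P'" unfolding H_def by auto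
    moreover from this have "P \<noteq> P'" by (auto simp: divide_le_0_iff)
    ultimately show "y \<in> ambiguous" unfolding ambiguous_def by blast
  qed
  ultimately show ?thesis by simp
qed

text \<open>The gradient of the optical path at the point \<open>Y\<close> of the surface in direction \<open>y\<close>, scaled so that its
  inner product with \<open>Y\<close> is \<open>1\<close>: the gradient at \<open>Y\<close> of the gauge of the oval through \<open>Y\<close>.\<close>

definition gauge_gradient :: "'a \<Rightarrow> 'a \<Rightarrow> 'a" where
  "gauge_gradient y P =
     (let g = y - \<kappa> *\<^sub>R ((P - \<rho> y *\<^sub>R y) /\<^sub>R norm (P - \<rho> y *\<^sub>R y)) in g /\<^sub>R (g \<bullet> (\<rho> y *\<^sub>R y)))"

lemma normal_inner_neg:
  assumes y: "y \<in> K" and P: "P \<in> D"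
  shows "(y - \<kappa> *\<^sub>R ((P - \<rho> y *\<^sub>R y) /\<^sub>R norm (P - \<rho> y *\<^sub>R y))) \<bullet> (\<rho> y *\<^sub>R y) < 0"
proof -
  have yy: "y \<bullet> y = 1" using y by (simp add: dot_square_norm)
  define n where "n = norm (P - \<rho> y *\<^sub>R y)"
  have n: "0 < n" "n < \<kappa> * (y \<bullet> P - \<rho> y)" 
    using off_target[OF y P, of "\<rho> y"] steep_strict[OF y P, of "\<rho> y"] radius[OF y] by (auto simp: n_def)
  have "(y - \<kappa> *\<^sub>R ((P - \<rho> y *\<^sub>R y) /\<^sub>R n)) \<bullet> y = 1 - \<kappa> * ((P - \<rho> y *\<^sub>R y) \<bullet> y) / n"
    unfolding inner_diff_left[of y] using yy by (simp add: divide_inverse mult.commute)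
  also have "(P - \<rho> y *\<^sub>R y) \<bullet> y = y \<bullet> P - \<rho> y"
    using yy by (simp add: inner_diff_left inner_diff_right inner_commute)
  finally have "(y - \<kappa> *\<^sub>R ((P - \<rho> y *\<^sub>R y) /\<^sub>R n)) \<bullet> y = 1 - \<kappa> * (y \<bullet> P - \<rho> y) / n" .
  also have "\<dots> < 0" using n by simp
  finally show ?thesis using radius[OF y] by (simp add: n_def mult_pos_neg)
qed

text \<open>The optical path is convex, so its gradient \<open>g\<close> at the contact point \<open>Y\<close> satisfies \<open>g \<bullet> X \<le> g \<bullet> Y\<close> for
  all \<open>X\<close> on the surface; the inequality turns around after division by \<open>g \<bullet> Y < 0\<close>. Convexity
  enters through Cauchy-Schwarz for the two norms.\<close>

lemma gauge_supergradient:
  assumes y: "y \<in> K" and P: "P \<in> D" and t: "touches \<kappa> K \<rho> P y"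
  shows "gauge_gradient y P \<bullet> y = 1 / \<rho> y" and "x \<in> K \<Longrightarrow> 1 / \<rho> x \<le> gauge_gradient y P \<bullet> x"
proof -
  define Y where "Y = \<rho> y *\<^sub>R y"
  define m where "m = (P - Y) /\<^sub>R norm (P - Y)"
  define g where "g = y - \<kappa> *\<^sub>R m"
  have gY: "g \<bullet> Y < 0" using normal_inner_neg[OF y P] unfolding g_def m_def Y_def .
  have gg: "gauge_gradient y P = g /\<^sub>R (g \<bullet> Y)"
    unfolding gauge_gradient_def g_def m_def Y_def Let_def ..
  have "gauge_gradient y P \<bullet> Y = 1" unfolding gg using gY by simp
  then have "\<rho> y * (gauge_gradient y P \<bullet> y) = 1" by (simp add: Y_def)
  then show "gauge_gradient y P \<bullet> y = 1 / \<rho> y" using radius[OF y] by (simp add: field_simps)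
  assume x: "x \<in> K"
  have nP: "norm (P - Y) > 0" using off_target[OF y P, of "\<rho> y"] radius[OF y] by (simp add: Y_def)
  have m1: "norm m = 1" unfolding m_def using nP by simp
  have y1: "norm y = 1" using y by simp
  define X where "X = \<rho> x *\<^sub>R x"
  have "y \<bullet> X + \<kappa> * (m \<bullet> (P - X)) \<le> norm X + \<kappa> * norm (P - X)"
    using norm_cauchy_schwarz[of y X] norm_cauchy_schwarz[of m "P - X"] kappa
    by (intro add_mono mult_left_mono) (auto simp: y1 m1)
  also have "\<dots> \<le> norm Y + \<kappa> * norm (P - Y)"
    using t x unfolding touches_def optical_path_def X_def Y_def by auto
  also have "\<dots> = y \<bullet> Y + \<kappa> * (m \<bullet> (P - Y))"
  proof -
    have "norm Y = y \<bullet> Y" unfolding Y_def using radius[OF y] y1 by (simp add: dot_square_norm)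
    moreover have "m \<bullet> (P - Y) = norm (P - Y)" unfolding m_def using nP
      by (simp add: dot_square_norm power2_eq_square)
    ultimately show ?thesis by simp
  qed
  finally have "g \<bullet> X \<le> g \<bullet> Y" unfolding g_def by (simp add: inner_diff_left inner_diff_right algebra_simps)
  then have "1 \<le> gauge_gradient y P \<bullet> X" unfolding gg using gY
    by (simp add: divide_inverse[symmetric] inverse_eq_divide le_divide_eq)
  then have "1 \<le> \<rho> x * (gauge_gradient y P \<bullet> x)" by (simp add: X_def)
  then show "1 / \<rho> x \<le> gauge_gradient y P \<bullet> x" using radius[OF x] by (simp add: field_simps)
qed

end

text \<open>A refracted ray meets the target at most once.\<close>

locale visible_refraction = refraction +
  assumes ray_unique: "\<lbrakk>x \<in> K; 0 < t; t \<le> r0; norm m = 1; P \<in> D; P' \<in> D; 0 \<le> s; 0 \<le> s';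
     P = t *\<^sub>R x + s *\<^sub>R m; P' = t *\<^sub>R x + s' *\<^sub>R m\<rbrakk> \<Longrightarrow> P = P'"

locale visible_refractor = refractor \<kappa> \<delta> r0 K D \<rho> + visible_refraction \<kappa> \<delta> r0 K D
  for \<kappa> \<delta> r0 :: real and K D :: "'a::euclidean_space set" and \<rho>
begin

lemma gauge_gradient_inj:
  assumes y: "y \<in> K" and P: "P \<in> D" "P' \<in> D" and eq: "gauge_gradient y P = gauge_gradient y P'"
  shows "P = P'"
proof -
  define Y where "Y = \<rho> y *\<^sub>R y"
  define m where "m P = (P - Y) /\<^sub>R norm (P - Y)" for P
  define g where "g P = y - \<kappa> *\<^sub>R m P" for P
  have gY: "g P \<bullet> Y < 0" if "P \<in> D" for P
    using normal_inner_neg[OF y that] unfolding g_def m_def Y_def .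
  have gg: "gauge_gradient y P = g P /\<^sub>R (g P \<bullet> Y)" for P
    unfolding gauge_gradient_def g_def m_def Y_def Let_def ..
  have nP: "norm (P - Y) > 0" if "P \<in> D" for P
    using off_target[OF y that, of "\<rho> y"] radius[OF y] by (simp add: Y_def)
  have m1: "norm (m P) = 1" if "P \<in> D" for P unfolding m_def using nP[OF that] by simp
  define c where "c = (g P \<bullet> Y) / (g P' \<bullet> Y)"
  have c: "c > 0" using gY P unfolding c_def by (simp add: divide_neg_neg)
  have "(g P \<bullet> Y) *\<^sub>R gauge_gradient y P = g P"
    unfolding gg using gY[OF P(1)] by simp
  moreover have "(g P \<bullet> Y) *\<^sub>R gauge_gradient y P' = c *\<^sub>R g P'"
    unfolding gg c_def by (simp add: divide_inverse)
  ultimately have "g P = c *\<^sub>R g P'" unfolding eq by simp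
  then have "m P = m P'"
    using refraction_direction_unique[OF kappa norm_K[OF y] m1[OF P(1)] m1[OF P(2)] c]
    unfolding g_def by simp
  moreover have "Q = Y + norm (Q - Y) *\<^sub>R m Q" if "Q \<in> D" for Q
    unfolding m_def using nP[OF that] by simp
  ultimately show ?thesis
    using ray_unique[OF y, of "\<rho> y" "m P" P P' "norm (P - Y)" "norm (P' - Y)"] radius[OF y] P m1
    unfolding Y_def by (metis norm_ge_zero)
qed

text \<open>At a point of this cone the gauge of the surface has the two supergradients that belong to two
  different targets.\<close>

lemma negligible_ambiguous_cone:
  assumes \<Omega>: "openin (top_of_set (sphere 0 1)) \<Omega>" "\<Omega> \<subseteq> K"
  shows "negligible {z. z \<noteq> 0 \<and> z /\<^sub>R norm z \<in> ambiguous \<inter> \<Omega>}"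
proof -
  define U where "U = {z. z \<noteq> 0 \<and> z /\<^sub>R norm z \<in> \<Omega>}"
  define V where "V z = norm z / \<rho> (z /\<^sub>R norm z)" for z
  have cont: "continuous_on (- {0}) (\<lambda>z::'a. z /\<^sub>R norm z)"
    by (intro continuous_intros) auto
  have U: "open U"
  proof -
    obtain T where T: "open T" "\<Omega> = T \<inter> sphere 0 1" using \<Omega>(1) unfolding openin_open by auto
    have "U = (- {0}) \<inter> (\<lambda>z. z /\<^sub>R norm z) -` T" unfolding U_def T by auto
    then show ?thesis using continuous_open_preimage[OF cont _ T(1)] by (simp add: open_Compl)
  qed
  have V: "continuous_on U V" unfolding V_def
  proof (intro continuous_intros)
    show "continuous_on U (\<lambda>z. \<rho> (z /\<^sub>R norm z))"
      by (rule continuous_on_compose2[OF continuous_radius])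
        (use \<Omega>(2) in \<open>auto simp: U_def intro!: continuous_intros\<close>)
    show "\<forall>z\<in>U. \<rho> (z /\<^sub>R norm z) \<noteq> 0" using radius \<Omega>(2) unfolding U_def by fastforce
  qed
  have "{z. z \<noteq> 0 \<and> z /\<^sub>R norm z \<in> ambiguous \<inter> \<Omega>} \<subseteq>
     {z \<in> U. \<exists>p q. p \<noteq> q \<and> (\<forall>w\<in>U. V w \<le> V z + p \<bullet> (w - z)) \<and> (\<forall>w\<in>U. V w \<le> V z + q \<bullet> (w - z))}"
  proof
    fix z assume "z \<in> {z. z \<noteq> 0 \<and> z /\<^sub>R norm z \<in> ambiguous \<inter> \<Omega>}"
    then have z: "z \<noteq> 0" "z /\<^sub>R norm z \<in> ambiguous" "z /\<^sub>R norm z \<in> \<Omega>" by auto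
    define y where "y = z /\<^sub>R norm z"
    obtain P P' where y: "y \<in> K" and P: "P \<in> D" "touches \<kappa> K \<rho> P y" and P': "P' \<in> D" "touches \<kappa> K \<rho> P' y"
      and ne: "P \<noteq> P'" using z(2) unfolding ambiguous_def y_def[symmetric] by auto
    have zy: "z = norm z *\<^sub>R y" using z by (simp add: y_def)
    have sup: "V w \<le> V z + gauge_gradient y Q \<bullet> (w - z)" if Q: "Q \<in> D" "touches \<kappa> K \<rho> Q y" and w: "w \<in> U" for w Q
    proof -
      have "gauge_gradient y Q \<bullet> z = norm z * (gauge_gradient y Q \<bullet> y)" using zy by (metis inner_scaleR_right)
      also have "\<dots> = V z" using gauge_supergradient(1)[OF y Q] by (simp add: V_def y_def)
      finally have 1: "gauge_gradient y Q \<bullet> z = V z" .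
      define x where "x = w /\<^sub>R norm w"
      have x: "x \<in> K" "w = norm w *\<^sub>R x" using w \<Omega>(2) unfolding U_def x_def by auto
      have "V w = norm w * (1 / \<rho> x)" by (simp add: V_def x_def)
      also have "\<dots> \<le> norm w * (gauge_gradient y Q \<bullet> x)"
        using gauge_supergradient(2)[OF y Q x(1)] by (intro mult_left_mono) auto
      also have "\<dots> = gauge_gradient y Q \<bullet> w" using x(2) by (metis inner_scaleR_right)
      finally show ?thesis using 1 by (simp add: inner_diff_right)
    qed
    have "z \<in> U" using z by (simp add: U_def)
    then show "z \<in> {z \<in> U. \<exists>p q. p \<noteq> q \<and> (\<forall>w\<in>U. V w \<le> V z + p \<bullet> (w - z)) \<and> (\<forall>w\<in>U. V w \<le> V z + q \<bullet> (w - z))}"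
      using sup[OF P] sup[OF P'] ne gauge_gradient_inj[OF y P(1) P'(1)] by blast
  qed
  with negligible_two_supergradients[OF U V] show ?thesis by (rule negligible_subset)
qed

end

section \<open>A variational inequality on the cube\<close>

text \<open>Bolzano-Weierstrass for vectors given as functions on \<open>{..<N}\<close>, where the dimension \<open>N\<close> is a variable.\<close>

lemma bounded_coordinates_subsequence:
  fixes X :: "nat \<Rightarrow> nat \<Rightarrow> real"
  assumes "\<And>k j. j < N \<Longrightarrow> X k j \<in> {0..1}"
  shows "\<exists>r x. strict_mono (r :: nat \<Rightarrow> nat) \<and> (\<forall>j<N. x j \<in> {0..1} \<and> (\<lambda>k. X (r k) j) \<longlonglongrightarrow> x j)"
  using assms
proof (induction N)
  case 0
  show ?case by (intro exI[of _ id]) (auto simp: strict_mono_def)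
next
  case (Suc N)
  then obtain r x where r: "strict_mono (r :: nat \<Rightarrow> nat)"
    and x: "\<And>j. j < N \<Longrightarrow> x j \<in> {0..1} \<and> (\<lambda>k. X (r k) j) \<longlonglongrightarrow> x j"
    using less_SucI by metis
  have "\<forall>k. X (r k) N \<in> {0..1::real}" using Suc.prems by simp
  then obtain l s where l: "l \<in> {0..1::real}" "strict_mono (s :: nat \<Rightarrow> nat)" "((\<lambda>k. X (r k) N) \<circ> s) \<longlonglongrightarrow> l"
    using seq_compactE[of "{0..1::real}" "\<lambda>k. X (r k) N"] compact_imp_seq_compact[OF compact_Icc] by metis
  have "(\<lambda>k. X ((r \<circ> s) k) j) \<longlonglongrightarrow> (x(N := l)) j" if "j < Suc N" for j
  proof (cases "j = N")
    case True
    then show ?thesis using l(3) by (simp add: o_def)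
  next
    case False
    then have "(\<lambda>k. X (r k) j) \<longlonglongrightarrow> x j" using x that by auto
    from LIMSEQ_subseq_LIMSEQ[OF this l(2)] False show ?thesis by (simp add: o_def)
  qed
  moreover have "(x(N := l)) j \<in> {0..1}" if "j < Suc N" for j using x l(1) that by (auto simp: less_Suc_eq)
  ultimately show ?case using strict_mono_o[OF r l(2)] by blast
qed

text \<open>Label a point of a fine grid in coordinate \<open>i\<close> by the sign of \<open>F\<^sub>i\<close>, except that the labels on the two
  faces orthogonal to that coordinate are prescribed. Kuhn's lemma yields a small cube where both
  labels occur in every coordinate. In the limit of ever finer grids, a point that carries label \<open>1\<close> gives
  \<open>F\<^sub>i \<ge> 0\<close> unless it comes from the face \<open>x\<^sub>i = 1\<close>, and dually for label \<open>0\<close>.\<close>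

lemma box_variational_inequality:
  fixes F :: "(nat \<Rightarrow> real) \<Rightarrow> nat \<Rightarrow> real"
  assumes cont: "\<And>X x i. \<lbrakk>i < N; \<And>k j. j < N \<Longrightarrow> X k j \<in> {0..1}; \<And>j. j < N \<Longrightarrow> x j \<in> {0..1};
       \<And>j. j < N \<Longrightarrow> (\<lambda>k. X k j) \<longlonglongrightarrow> x j\<rbrakk> \<Longrightarrow> (\<lambda>k. F (X k) i) \<longlonglongrightarrow> F x i"
  obtains x where "\<And>i. i < N \<Longrightarrow> x i \<in> {0..1}" "\<And>i. i < N \<Longrightarrow> x i < 1 \<Longrightarrow> 0 \<le> F x i"
    "\<And>i. i < N \<Longrightarrow> 0 < x i \<Longrightarrow> F x i \<le> 0"
proof -
  \<comment> \<open>The grid has \<open>p + 1\<close> steps per edge; the offset avoids a division by zero.\<close>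
  define sc where "sc p y = (\<lambda>j. real (y j) / real (Suc p))" for p and y :: "nat \<Rightarrow> nat"
  define label where "label p y i =
    (if y i = 0 then 0 else if y i = Suc p \<or> 0 < F (sc p y) i then 1 else (0::nat))" for p y i
  define near where "near Q r \<longleftrightarrow> (\<forall>j<N. Q j \<le> r j \<and> r j \<le> Q j + 1)" for Q r :: "nat \<Rightarrow> nat"
  have "\<exists>Q. (\<forall>i<N. Q i < Suc p) \<and> (\<forall>i<N. \<exists>r s. near Q r \<and> near Q s \<and> label p r i = 1 \<and> label p s i = 0)" for p
  proof -
    obtain Q where Q: "\<forall>i<N. Q i < Suc p"
      and "\<forall>i<N. \<exists>r s. (\<forall>j<N. Q j \<le> r j \<and> r j \<le> Q j + 1) \<and> (\<forall>j<N. Q j \<le> s j \<and> s j \<le> Q j + 1) \<and>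
             label p r i \<noteq> label p s i"
      by (rule kuhn_lemma[of "Suc p" N "label p"]) (auto simp: label_def)
    then have "\<forall>i<N. \<exists>r s. near Q r \<and> near Q s \<and> label p r i \<noteq> label p s i" unfolding near_def by blast
    moreover have "label p r i = 0 \<or> label p r i = 1" for r i unfolding label_def by auto
    ultimately have "\<exists>r s. near Q r \<and> near Q s \<and> label p r i = 1 \<and> label p s i = 0" if "i < N" for i
      using that by metis
    then show ?thesis using Q by blast
  qed
  then have "\<exists>Q. \<forall>p. (\<forall>i<N. Q p i < Suc p) \<and>
      (\<forall>i<N. \<exists>r s. near (Q p) r \<and> near (Q p) s \<and> label p r i = 1 \<and> label p s i = 0)"
    by (intro choice allI)
  then obtain Q where Q_all: "\<forall>p. (\<forall>i<N. Q p i < Suc p) \<and>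
      (\<forall>i<N. \<exists>r s. near (Q p) r \<and> near (Q p) s \<and> label p r i = 1 \<and> label p s i = 0)" ..
  have Q: "Q p i < Suc p" if "i < N" for p i using Q_all that by blast
  have RS: "\<exists>r s. near (Q p) r \<and> near (Q p) s \<and> label p r i = 1 \<and> label p s i = 0" if "i < N" for p i
    using Q_all that by blast
  define R where "R p i = (SOME r. near (Q p) r \<and> label p r i = 1)" for p i
  define S where "S p i = (SOME s. near (Q p) s \<and> label p s i = 0)" for p i
  have R: "near (Q p) (R p i) \<and> label p (R p i) i = 1" if "i < N" for p i
    unfolding R_def using RS[OF that, of p] by (intro someI_ex[where P = "\<lambda>r. near (Q p) r \<and> label p r i = 1"]) auto
  have S: "near (Q p) (S p i) \<and> label p (S p i) i = 0" if "i < N" for p i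
    unfolding S_def using RS[OF that, of p] by (intro someI_ex[where P = "\<lambda>s. near (Q p) s \<and> label p s i = 0"]) auto
  have "sc p (Q p) j \<in> {0..1}" if "j < N" for p j
    using Q[OF that, of p] by (auto simp: sc_def divide_le_eq)
  then obtain r x where r: "strict_mono (r :: nat \<Rightarrow> nat)"
    and x: "\<And>j. j < N \<Longrightarrow> x j \<in> {0..1} \<and> (\<lambda>k. sc (r k) (Q (r k)) j) \<longlonglongrightarrow> x j"
    using bounded_coordinates_subsequence[of N "\<lambda>p. sc p (Q p)"] by auto
  have inv0: "(\<lambda>k. 1 / real (Suc (r k))) \<longlonglongrightarrow> 0"
    using LIMSEQ_subseq_LIMSEQ[OF LIMSEQ_inverse_real_of_nat r] by (simp add: o_def inverse_eq_divide)
  have near: "(\<lambda>k. sc (r k) (T (r k)) j) \<longlonglongrightarrow> x j" "sc p (T p) j \<in> {0..1}"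
    if T: "\<And>p. near (Q p) (T p)" and j: "j < N" for T j p
  proof -
    have 1: "sc p (Q p) j \<le> sc p (T p) j" "sc p (T p) j \<le> sc p (Q p) j + 1 / real (Suc p)" for p
    proof -
      have "Q p j \<le> T p j" "T p j \<le> Q p j + 1" using T[of p] j unfolding near_def by auto
      then have "real (Q p j) \<le> real (T p j)" "real (T p j) \<le> real (Q p j) + 1" by linarith+
      then show "sc p (Q p) j \<le> sc p (T p) j" "sc p (T p) j \<le> sc p (Q p) j + 1 / real (Suc p)"
        unfolding sc_def by (simp_all add: divide_right_mono flip: add_divide_distrib)
    qed
    have xl: "(\<lambda>k. sc (r k) (Q (r k)) j) \<longlonglongrightarrow> x j" using x[OF j] by blast
    have xu: "(\<lambda>k. sc (r k) (Q (r k)) j + 1 / real (Suc (r k))) \<longlonglongrightarrow> x j"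
      using tendsto_add[OF xl inv0] by (simp only: add_0_right)
    show "(\<lambda>k. sc (r k) (T (r k)) j) \<longlonglongrightarrow> x j"
      by (rule tendsto_sandwich[OF _ _ xl xu]) (intro always_eventually allI 1)+
    have "T p j \<le> Suc p" using T[of p] Q[OF j, of p] j unfolding near_def by fastforce
    then have "real (T p j) \<le> real (Suc p)" by linarith
    then show "sc p (T p) j \<in> {0..1}" by (simp add: sc_def divide_le_eq)
  qed
  show ?thesis
  proof (rule that[of x])
    show "x i \<in> {0..1}" if "i < N" for i using x that by auto
  next
    fix i assume i: "i < N" and xi: "x i < 1"
    have T: "near (Q p) (R p i)" for p using R i by auto
    have "(\<lambda>k. F (sc (r k) (R (r k) i)) i) \<longlonglongrightarrow> F x i"
      by (rule cont[OF i]) (blast intro: near[of "\<lambda>p. R p i", OF T] dest: x)+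
    moreover have "\<forall>\<^sub>F k in sequentially. 0 \<le> F (sc (r k) (R (r k) i)) i"
      using order_tendstoD(2)[OF near(1)[of "\<lambda>p. R p i", OF T i] xi]
    proof eventually_elim
      case (elim k)
      have "label (r k) (R (r k) i) i = 1" using R[OF i] by auto
      moreover have "R (r k) i i \<noteq> Suc (r k)" using elim by (auto simp: sc_def)
      ultimately show ?case unfolding label_def by (auto split: if_splits)
    qed
    ultimately show "0 \<le> F x i" by (rule tendsto_lowerbound) simp
  next
    fix i assume i: "i < N" and xi: "0 < x i"
    have T: "near (Q p) (S p i)" for p using S i by auto
    have "(\<lambda>k. F (sc (r k) (S (r k) i)) i) \<longlonglongrightarrow> F x i"
      by (rule cont[OF i]) (blast intro: near[of "\<lambda>p. S p i", OF T] dest: x)+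
    moreover have "\<forall>\<^sub>F k in sequentially. F (sc (r k) (S (r k) i)) i \<le> 0"
      using order_tendstoD(1)[OF near(1)[of "\<lambda>p. S p i", OF T i] xi]
    proof eventually_elim
      case (elim k)
      have "label (r k) (S (r k) i) i = 0" using S[OF i] by auto
      moreover have "S (r k) i i \<noteq> 0"
        using elim unfolding sc_def by (metis div_0 less_irrefl of_nat_0)
      ultimately show ?case unfolding label_def by (auto split: if_splits)
    qed
    ultimately show "F x i \<le> 0" by (rule tendsto_upperbound) simp
  qed
qed

section \<open>Envelopes of ovals through a point\<close>

text \<open>The surfaces are to pass through \<open>t0 z\<close>; the second assumption says that an oval through this point
  reaches no farther than \<open>r0\<close>.\<close>

locale anchored_refraction = visible_refraction \<kappa> \<delta> r0 K D
  for \<kappa> \<delta> r0 :: real and K D :: "'a::euclidean_space set" +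
  fixes z :: 'a and t0 :: real
  assumes anchor: "z \<in> K" "0 < t0" "t0 \<le> r0"
    and anchor_low: "\<lbrakk>x \<in> K; P \<in> D\<rbrakk> \<Longrightarrow>
      optical_path \<kappa> P (r0 *\<^sub>R x) \<le> optical_path \<kappa> P (t0 *\<^sub>R z)"
begin

definition anchor_path :: "'a \<Rightarrow> real" where
  "anchor_path P = optical_path \<kappa> P (t0 *\<^sub>R z)"

text \<open>Parameters for which the envelope of the ovals passes through the anchor point. A parameter may exceed
  \<open>\<kappa> |p i|\<close>; then no oval belongs to it and the corresponding constraint on the envelope is void.\<close>

definition levels :: "nat \<Rightarrow> (nat \<Rightarrow> 'a) \<Rightarrow> (nat \<Rightarrow> real) \<Rightarrow> bool" where
  "levels N p b \<longleftrightarrow> (\<forall>i<N. p i \<in> D \<and> anchor_path (p i) \<le> b i) \<and> (\<exists>j<N. b j = anchor_path (p j))"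

definition envelope :: "nat \<Rightarrow> (nat \<Rightarrow> 'a) \<Rightarrow> (nat \<Rightarrow> real) \<Rightarrow> 'a \<Rightarrow> real" where
  "envelope N p b x = Inf {t \<in> {0..r0}. \<forall>i<N. optical_path \<kappa> (p i) (t *\<^sub>R x) \<le> b i}"

lemma envelope_props:
  assumes b: "levels N p b" and x: "x \<in> K"
  shows "0 \<le> envelope N p b x" "envelope N p b x \<le> r0"
    and "i < N \<Longrightarrow> optical_path \<kappa> (p i) (envelope N p b x *\<^sub>R x) \<le> b i"
    and "\<lbrakk>0 \<le> t; t \<le> r0; \<And>i. i < N \<Longrightarrow> optical_path \<kappa> (p i) (t *\<^sub>R x) \<le> b i\<rbrakk> \<Longrightarrow> envelope N p b x \<le> t"
proof -
  define S where "S = {t \<in> {0..r0}. \<forall>i<N. optical_path \<kappa> (p i) (t *\<^sub>R x) \<le> b i}"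
  have "S = {0..r0} \<inter> (\<Inter>i\<in>{..<N}. {t. optical_path \<kappa> (p i) (t *\<^sub>R x) \<le> b i})"
    unfolding S_def by auto
  moreover have "closed \<dots>"
    by (intro closed_Int closed_INT ballI closed_Collect_le continuous_intros closed_atLeastAtMost)
  ultimately have "closed S" by simp
  moreover have "r0 \<in> S" unfolding S_def using r0 anchor_low[OF x] b
    by (auto simp: levels_def anchor_path_def intro: order_trans)
  moreover have bdd: "bdd_below S" unfolding S_def by (rule bdd_belowI[of _ 0]) auto
  ultimately have "Inf S \<in> S" using closed_contains_Inf[of S] by auto
  then show "0 \<le> envelope N p b x" "envelope N p b x \<le> r0"
    "i < N \<Longrightarrow> optical_path \<kappa> (p i) (envelope N p b x *\<^sub>R x) \<le> b i"
    unfolding envelope_def S_def[symmetric] by (auto simp: S_def)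
  show "envelope N p b x \<le> t"
    if "0 \<le> t" "t \<le> r0" "\<And>i. i < N \<Longrightarrow> optical_path \<kappa> (p i) (t *\<^sub>R x) \<le> b i"
    unfolding envelope_def S_def[symmetric] using that bdd by (intro cInf_lower) (auto simp: S_def)
qed

lemma envelope_pos:
  assumes b: "levels N p b" and x: "x \<in> K"
  shows "0 < envelope N p b x"
proof -
  obtain j where j: "j < N" "b j = anchor_path (p j)" "p j \<in> D" using b unfolding levels_def by auto
  have "optical_path \<kappa> (p j) (envelope N p b x *\<^sub>R x) \<le> b j" by (rule envelope_props(3)[OF b x j(1)])
  also have "\<dots> < \<kappa> * norm (p j)"
    unfolding j(2) anchor_path_def by (rule optical_path_range(2)[OF anchor(1) j(3) anchor(2,3)])
  finally have "envelope N p b x \<noteq> 0" by auto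
  then show ?thesis using envelope_props(1)[OF b x] by simp
qed

text \<open>If all constraints were slack at the envelope, they would still hold slightly closer to the source.\<close>

lemma envelope_active:
  assumes b: "levels N p b" and x: "x \<in> K"
  shows "\<exists>i<N. optical_path \<kappa> (p i) (envelope N p b x *\<^sub>R x) = b i"
proof (rule ccontr)
  let ?r = "envelope N p b x"
  assume "\<not> ?thesis"
  then have lt: "optical_path \<kappa> (p i) (?r *\<^sub>R x) < b i" if "i < N" for i
    using envelope_props(3)[OF b x that] that by (meson order_less_le)
  have "\<forall>\<^sub>F s in at_left ?r. \<forall>i\<in>{..<N}. optical_path \<kappa> (p i) (s *\<^sub>R x) < b i"
  proof (rule eventually_ball_finite)
    show "\<forall>i\<in>{..<N}. \<forall>\<^sub>F s in at_left ?r. optical_path \<kappa> (p i) (s *\<^sub>R x) < b i"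
    proof
      fix i assume "i \<in> {..<N}"
      then have i: "i < N" by simp
      have "((\<lambda>s. optical_path \<kappa> (p i) (s *\<^sub>R x)) \<longlongrightarrow> optical_path \<kappa> (p i) (?r *\<^sub>R x)) (at_left ?r)"
        by (intro tendsto_intros)
      then show "\<forall>\<^sub>F s in at_left ?r. optical_path \<kappa> (p i) (s *\<^sub>R x) < b i"
        by (rule order_tendstoD(2)) (rule lt[OF i])
    qed
  qed simp
  moreover have "\<forall>\<^sub>F s in at_left ?r. s \<in> {0<..<?r}"
    by (rule eventually_at_leftI[OF _ envelope_pos[OF b x]])
  ultimately have "\<forall>\<^sub>F s in at_left ?r. s \<in> {0<..<?r} \<and> (\<forall>i\<in>{..<N}. optical_path \<kappa> (p i) (s *\<^sub>R x) < b i)"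
    by eventually_elim simp
  then obtain s where s: "0 < s" "s < ?r" "\<And>i. i < N \<Longrightarrow> optical_path \<kappa> (p i) (s *\<^sub>R x) < b i"
    using eventually_happens' trivial_limit_at_left_real by (smt (verit, best) greaterThanLessThan_iff lessThan_iff)
  have "?r \<le> s" using envelope_props(2)[OF b x] s by (intro envelope_props(4)[OF b x]) (auto intro: less_imp_le)
  then show False using s by simp
qed

lemma active_touches:
  assumes b: "levels N p b" and x: "x \<in> K" and i: "i < N"
    and act: "optical_path \<kappa> (p i) (envelope N p b x *\<^sub>R x) = b i"
  shows "touches \<kappa> K (envelope N p b) (p i) x"
  unfolding touches_def act using envelope_props(3)[OF b _ i] by blast

lemma envelope_refractor:
  assumes b: "levels N p b"
  shows "visible_refractor \<kappa> \<delta> r0 K D (envelope N p b)"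
proof -
  have "refractor \<kappa> \<delta> r0 K D (envelope N p b)"
  proof (unfold_locales)
    show "0 < envelope N p b x \<and> envelope N p b x \<le> r0" if "x \<in> K" for x
      using envelope_pos[OF b that] envelope_props(2)[OF b that] by simp
    show "\<exists>P\<in>D. touches \<kappa> K (envelope N p b) P y" if y: "y \<in> K" for y
    proof -
      obtain i where i: "i < N" "optical_path \<kappa> (p i) (envelope N p b y *\<^sub>R y) = b i"
        using envelope_active[OF b y] by blast
      then show ?thesis using active_touches[OF b y i] b unfolding levels_def by blast
    qed
  qed
  then show ?thesis by (intro visible_refractor.intro visible_refraction_axioms)
qed

lemma envelope_anchor:
  assumes b: "levels N p b"
  shows "envelope N p b z = t0"
proof (rule antisym)
  show "envelope N p b z \<le> t0"
    using anchor b by (intro envelope_props(4)[OF b anchor(1)]) (auto simp: levels_def anchor_path_def)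
  obtain j where j: "j < N" "b j = anchor_path (p j)" "p j \<in> D" using b unfolding levels_def by auto
  have "optical_path \<kappa> (p j) (envelope N p b z *\<^sub>R z) \<le> optical_path \<kappa> (p j) (t0 *\<^sub>R z)"
    using envelope_props(3)[OF b anchor(1) j(1)] j(2) by (simp add: anchor_path_def)
  then show "t0 \<le> envelope N p b z"
    using optical_path_le_iff[OF anchor(1) j(3), of t0 "envelope N p b z"] anchor
      envelope_props(1,2)[OF b anchor(1)] by simp
qed

text \<open>Moving outwards by \<open>e / \<delta>\<close> lowers every optical path by at least \<open>e\<close>.\<close>

lemma envelope_level_shift:
  assumes b: "levels N p b" "levels N p b'" and x: "x \<in> K" and e: "0 \<le> e"
    and le: "\<And>i. i < N \<Longrightarrow> b i \<le> b' i + e"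
  shows "envelope N p b' x \<le> envelope N p b x + e / \<delta>"
proof (cases "envelope N p b x + e / \<delta> \<le> r0")
  case True
  let ?r = "envelope N p b x"
  have ed: "0 \<le> e / \<delta>" using e delta by simp
  note r = envelope_props[OF b(1) x]
  have "optical_path \<kappa> (p i) ((?r + e / \<delta>) *\<^sub>R x) \<le> b' i" if i: "i < N" for i
  proof -
    have P: "p i \<in> D" using b(1) i unfolding levels_def by auto
    have "optical_path \<kappa> (p i) ((?r + e / \<delta>) *\<^sub>R x) + \<delta> * ((?r + e / \<delta>) - ?r) \<le> optical_path \<kappa> (p i) (?r *\<^sub>R x)"
      by (rule optical_path_decrease[OF x P r(1) _ True]) (use ed in simp)
    moreover have "\<delta> * ((?r + e / \<delta>) - ?r) = e" using delta by simp
    ultimately show ?thesis using r(3)[OF i] le[OF i] by linarith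
  qed
  then show ?thesis using ed r(1) by (intro envelope_props(4)[OF b(2) x _ True]) auto
next
  case False
  then show ?thesis using envelope_props(2)[OF b(2) x] by simp
qed

lemma envelope_tendsto:
  assumes b: "\<And>k. levels N p (b k)" "levels N p b'" and x: "x \<in> K"
    and lim: "\<And>i. i < N \<Longrightarrow> (\<lambda>k. b k i) \<longlonglongrightarrow> b' i"
  shows "(\<lambda>k. envelope N p (b k) x) \<longlonglongrightarrow> envelope N p b' x"
proof (rule LIMSEQ_I)
  fix r :: real assume r: "0 < r"
  define e where "e = r * \<delta> / 2"
  have e: "e > 0" using r delta by (simp add: e_def)
  have ed: "e / \<delta> < r" using r delta by (simp add: e_def)
  have "\<forall>\<^sub>F k in sequentially. \<forall>i\<in>{..<N}. dist (b k i) (b' i) < e"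
    using lim e by (intro eventually_ball_finite) (auto intro: tendstoD)
  then obtain M where M: "\<And>k i. k \<ge> M \<Longrightarrow> i < N \<Longrightarrow> \<bar>b k i - b' i\<bar> < e"
    unfolding eventually_sequentially dist_real_def by auto
  show "\<exists>M. \<forall>k\<ge>M. norm (envelope N p (b k) x - envelope N p b' x) < r"
  proof (intro exI allI impI)
    fix k assume k: "M \<le> k"
    have "envelope N p b' x \<le> envelope N p (b k) x + e / \<delta>"
      using M[OF k] e by (intro envelope_level_shift[OF b(1) b(2) x]) force+
    moreover have "envelope N p (b k) x \<le> envelope N p b' x + e / \<delta>"
      using M[OF k] e by (intro envelope_level_shift[OF b(2) b(1) x]) force+
    ultimately show "norm (envelope N p (b k) x - envelope N p b' x) < r" using ed by simp
  qed
qed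

text \<open>Directions that the envelope refracts to \<open>p i\<close>. Only contact at the level \<open>b i\<close> counts: if the
  constraint \<open>i\<close> is slack everywhere, the cell is empty.\<close>

definition cell :: "nat \<Rightarrow> (nat \<Rightarrow> 'a) \<Rightarrow> (nat \<Rightarrow> real) \<Rightarrow> nat \<Rightarrow> 'a set" where
  "cell N p b i = {x \<in> K. optical_path \<kappa> (p i) (envelope N p b x *\<^sub>R x) = b i}"

lemma cell_subset: "cell N p b i \<subseteq> K"
  unfolding cell_def by auto

lemma cell_cover:
  assumes b: "levels N p b"
  shows "(\<Union>i<N. cell N p b i) = K"
proof
  show "K \<subseteq> (\<Union>i<N. cell N p b i)"
  proof
    fix x assume x: "x \<in> K"
    obtain i where "i < N" "optical_path \<kappa> (p i) (envelope N p b x *\<^sub>R x) = b i"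
      using envelope_active[OF b x] by blast
    then show "x \<in> (\<Union>i<N. cell N p b i)" using x unfolding cell_def by auto
  qed
qed (use cell_subset in blast)

lemma closed_cell:
  assumes b: "levels N p b"
  shows "closed (cell N p b i)"
proof -
  interpret R: visible_refractor \<kappa> \<delta> r0 K D "envelope N p b" by (rule envelope_refractor[OF b])
  have "continuous_on K (\<lambda>x. optical_path \<kappa> (p i) (envelope N p b x *\<^sub>R x))"
    by (intro continuous_intros R.continuous_radius)
  then have "closed {x \<in> K. optical_path \<kappa> (p i) (envelope N p b x *\<^sub>R x) = b i}"
    using continuous_closed_preimage_constant compact_imp_closed[OF K(1)] by blast
  then show ?thesis unfolding cell_def .
qed

lemma cell_overlap:
  assumes b: "levels N p b" and inj: "inj_on p {..<N}" and ij: "i < N" "j < N" "i \<noteq> j"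
  shows "cell N p b i \<inter> cell N p b j \<subseteq> refractor.ambiguous \<kappa> K D (envelope N p b)"
proof
  interpret R: visible_refractor \<kappa> \<delta> r0 K D "envelope N p b" by (rule envelope_refractor[OF b])
  fix x assume x: "x \<in> cell N p b i \<inter> cell N p b j"
  have "p i \<noteq> p j" using inj ij by (auto dest: inj_onD)
  then show "x \<in> R.ambiguous"
    using x active_touches[OF b _ ij(1)] active_touches[OF b _ ij(2)] b ij
    unfolding R.ambiguous_def cell_def levels_def by blast
qed

lemma cell_empty:
  assumes b: "levels N p b" and i: "i < N" and large: "\<kappa> * norm (p i) \<le> b i"
  shows "cell N p b i = {}"
proof -
  have "optical_path \<kappa> (p i) (envelope N p b x *\<^sub>R x) < b i" if "x \<in> K" for x
    using optical_path_range(2)[OF that, of "p i" "envelope N p b x"] large b i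
      envelope_pos[OF b that] envelope_props(2)[OF b that] unfolding levels_def by fastforce
  then show ?thesis unfolding cell_def by fastforce
qed

end

section \<open>Refractors for finitely many targets\<close>

text \<open>Reverse Fatou inequality for sets.\<close>

lemma (in finite_measure) measure_limsup_ge:
  fixes E :: "nat \<Rightarrow> 'a set"
  assumes E: "\<And>k. E k \<in> sets M" and L: "L \<in> sets M"
    and limsup: "\<And>x. \<exists>\<^sub>\<infinity>k. x \<in> E k \<Longrightarrow> x \<in> L"
    and c: "\<exists>\<^sub>\<infinity>k. c \<le> measure M (E k)"
  shows "c \<le> measure M L"
proof -
  \<comment> \<open>The unions of the tails decrease to the set of points in infinitely many \<open>E k\<close>.\<close>
  define T where "T n = (\<Union>k\<in>{n..}. E k)" for n :: nat
  have T: "T n \<in> sets M" for n unfolding T_def using E by auto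
  have "c \<le> measure M (T n)" for n
  proof -
    obtain k where k: "k > n" "c \<le> measure M (E k)" using c unfolding INFM_nat by auto
    have "k \<in> {n..}" using k(1) by simp
    then have "E k \<subseteq> T n" unfolding T_def by blast
    then have "measure M (E k) \<le> measure M (T n)" by (rule finite_measure_mono) (rule T)
    then show ?thesis using k by simp
  qed
  moreover have "decseq T" unfolding T_def decseq_def by (auto 0 3 intro: order_trans)
  then have "(\<lambda>n. measure M (T n)) \<longlonglongrightarrow> measure M (\<Inter>n. T n)"
    using T by (intro finite_Lim_measure_decseq) auto
  ultimately have "c \<le> measure M (\<Inter>n. T n)" by (intro LIMSEQ_le_const) auto
  also have "\<dots> \<le> measure M L"
  proof (rule finite_measure_mono[OF _ L])
    show "(\<Inter>n. T n) \<subseteq> L"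
    proof
      fix x assume "x \<in> (\<Inter>n. T n)"
      then have "\<exists>k\<ge>n. x \<in> E k" for n unfolding T_def by auto
      then show "x \<in> L" by (intro limsup) (simp add: INFM_nat_le)
    qed
  qed
  finally show ?thesis .
qed

lemma tendsto_if_usc_and_sum:
  fixes a :: "nat \<Rightarrow> 'i \<Rightarrow> real"
  assumes I: "finite I" and i: "i \<in> I"
    and usc: "\<And>i e. i \<in> I \<Longrightarrow> 0 < e \<Longrightarrow> \<forall>\<^sub>F k in sequentially. a k i < l i + e"
    and total: "\<And>k. (\<Sum>i\<in>I. a k i) = (\<Sum>i\<in>I. l i)"
  shows "(\<lambda>k. a k i) \<longlonglongrightarrow> l i"
proof (rule tendstoI)
  fix e :: real assume e: "e > 0"
  \<comment> \<open>If each term exceeds its limit by at most \<open>e / |I|\<close>, none can fall short by \<open>e\<close>.\<close>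
  define d where "d = e / real (card I)"
  have cI: "card I > 0" using I i by (auto simp: card_gt_0_iff)
  have d: "d > 0" "real (card I) * d = e" using e cI by (auto simp: d_def)
  have "\<forall>\<^sub>F k in sequentially. \<forall>j\<in>I. a k j < l j + d"
    using usc d I by (intro eventually_ball_finite) auto
  then show "\<forall>\<^sub>F k in sequentially. dist (a k i) (l i) < e"
  proof eventually_elim
    case (elim k)
    have "(\<Sum>j\<in>I. a k j) = a k i + (\<Sum>j\<in>I - {i}. a k j)" "(\<Sum>j\<in>I. l j) = l i + (\<Sum>j\<in>I - {i}. l j)"
      using I i by (auto intro: sum.remove)
    moreover have "(\<Sum>j\<in>I - {i}. a k j) \<le> (\<Sum>j\<in>I - {i}. l j + d)"
      using elim by (intro sum_mono) (auto intro: less_imp_le)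
    moreover have "(\<Sum>j\<in>I - {i}. l j + d) = (\<Sum>j\<in>I - {i}. l j) + (real (card I) - 1) * d"
      using i I cI by (simp add: sum.distrib of_nat_diff)
    ultimately have "l i - a k i \<le> (real (card I) - 1) * d" using total[of k] by linarith
    also have "\<dots> = e - d" using d by (simp add: algebra_simps)
    finally have "l i - a k i < e" using d by simp
    moreover have "d \<le> e" using d cI mult_right_mono[of 1 "real (card I)" d] by simp
    then have "a k i - l i < e" using elim i by fastforce
    ultimately show ?case by (simp add: dist_real_def abs_less_iff)
  qed
qed

text \<open>The maximum of \<open>0\<close> and the first \<open>n\<close> values, in a form whose continuity is an easy induction.\<close>

primrec peak :: "nat \<Rightarrow> (nat \<Rightarrow> real) \<Rightarrow> real" where
  "peak 0 x = 0"
| "peak (Suc n) x = max (peak n x) (x n)"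

lemma le_peak: "i < n \<Longrightarrow> x i \<le> peak n x"
  by (induction n) (auto simp: less_Suc_eq le_max_iff_disj)

lemma peak_le_1: "(\<And>i. i < n \<Longrightarrow> x i \<le> 1) \<Longrightarrow> peak n x \<le> 1"
  by (induction n) auto

lemma peak_attained:
  assumes "0 < n" "\<And>i. i < n \<Longrightarrow> 0 \<le> x i"
  shows "\<exists>i<n. x i = peak n x"
  using assms
proof (induction n)
  case (Suc n)
  show ?case
  proof (cases "n = 0")
    case True
    then show ?thesis using Suc.prems(2)[of 0] by (intro exI[of _ 0]) (auto simp: max_def)
  next
    case False
    then obtain i where "i < n" "x i = peak n x" using Suc by auto
    then show ?thesis by (cases "peak n x \<le> x n") (auto simp: max_def less_Suc_eq)
  qed
qed simp

lemma tendsto_peak: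
  assumes "\<And>i. i < n \<Longrightarrow> (\<lambda>k. X k i) \<longlonglongrightarrow> x i"
  shows "(\<lambda>k. peak n (X k)) \<longlonglongrightarrow> peak n x"
  using assms by (induction n) (auto intro!: tendsto_max)

text \<open>The measure \<open>M\<close> is the emitted energy \<open>f dx\<close>. Subsets of ambiguous directions are required to be
  measurable, since preimages of Borel sets are Borel only up to such subsets.\<close>

locale emitting_refraction = anchored_refraction \<kappa> \<delta> r0 K D z t0 + finite_measure M
  for \<kappa> \<delta> r0 :: real and K D :: "'a::euclidean_space set" and z t0 and M :: "'a measure" +
  assumes borel_sets: "\<lbrakk>S \<in> sets borel; S \<subseteq> K\<rbrakk> \<Longrightarrow> S \<in> sets M"
    and ambiguous_null: "\<lbrakk>visible_refractor \<kappa> \<delta> r0 K D \<rho>; S \<subseteq> refractor.ambiguous \<kappa> K D \<rho>\<rbrakk>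
      \<Longrightarrow> S \<in> null_sets M"
begin

lemma cell_sets: "levels N p b \<Longrightarrow> cell N p b i \<in> sets M"
  using closed_cell cell_subset by (intro borel_sets) auto

lemma sum_cells:
  assumes b: "levels N p b" and inj: "inj_on p {..<N}" and I: "I \<subseteq> {..<N}"
  shows "(\<Sum>i\<in>I. measure M (cell N p b i)) = measure M (\<Union>i\<in>I. cell N p b i)"
proof -
  define A where "A = refractor.ambiguous \<kappa> K D (envelope N p b)"
  have A: "A \<in> null_sets M" unfolding A_def by (rule ambiguous_null[OF envelope_refractor[OF b] order_refl])
  have fin: "finite I" using I finite_subset by blast
  have cs: "cell N p b i \<in> sets M" for i by (rule cell_sets[OF b])
  have "(\<Sum>i\<in>I. measure M (cell N p b i)) = (\<Sum>i\<in>I. measure M (cell N p b i - A))"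
    by (simp add: measure_Diff_null_set[OF cs A])
  also have "\<dots> = measure M (\<Union>i\<in>I. cell N p b i - A)"
  proof (rule finite_measure_finite_Union[symmetric, OF fin])
    show "(\<lambda>i. cell N p b i - A) ` I \<subseteq> sets M" using cs A by auto
    show "disjoint_family_on (\<lambda>i. cell N p b i - A) I"
      unfolding disjoint_family_on_def
    proof (intro ballI impI)
      fix i j assume "i \<in> I" "j \<in> I" "i \<noteq> j"
      then show "(cell N p b i - A) \<inter> (cell N p b j - A) = {}"
        using cell_overlap[OF b inj, of i j] I unfolding A_def by auto
    qed
  qed
  also have "(\<Union>i\<in>I. cell N p b i - A) = (\<Union>i\<in>I. cell N p b i) - A" by auto
  also have "measure M \<dots> = measure M (\<Union>i\<in>I. cell N p b i)"
    using cs fin by (intro measure_Diff_null_set A) auto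
  finally show ?thesis .
qed

lemma sum_cells_total:
  assumes "levels N p b" "inj_on p {..<N}"
  shows "(\<Sum>i<N. measure M (cell N p b i)) = measure M K"
  using sum_cells[OF assms order_refl] cell_cover[OF assms(1)] by simp

text \<open>Contact is a closed condition, so directions that lie in infinitely many of the cells lie in the limiting
  one, and the energies are upper semicontinuous. As they sum to the total energy, they converge.\<close>

lemma cell_measure_tendsto:
  assumes b: "\<And>k. levels N p (b k)" "levels N p b'" and inj: "inj_on p {..<N}"
    and lim: "\<And>i. i < N \<Longrightarrow> (\<lambda>k. b k i) \<longlonglongrightarrow> b' i" and i: "i < N"
  shows "(\<lambda>k. measure M (cell N p (b k) i)) \<longlonglongrightarrow> measure M (cell N p b' i)"
proof (rule tendsto_if_usc_and_sum[of "{..<N}"])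
  fix i and e :: real assume i: "i \<in> {..<N}" and e: "0 < e"
  show "\<forall>\<^sub>F k in sequentially. measure M (cell N p (b k) i) < measure M (cell N p b' i) + e"
  proof (rule ccontr)
    assume "\<not> ?thesis"
    then have inf: "\<exists>\<^sub>\<infinity>k. measure M (cell N p b' i) + e \<le> measure M (cell N p (b k) i)"
      unfolding cofinite_eq_sequentially not_eventually by (simp add: not_less)
    have "measure M (cell N p b' i) + e \<le> measure M (cell N p b' i)"
    proof (rule measure_limsup_ge[OF _ _ _ inf])
      show "cell N p (b k) i \<in> sets M" "cell N p b' i \<in> sets M" for k
        using cell_sets b by auto
      fix x assume fr: "\<exists>\<^sub>\<infinity>k. x \<in> cell N p (b k) i"
      then obtain k where "x \<in> cell N p (b k) i" by (metis INFM_EX)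
      then have x: "x \<in> K" using cell_subset by blast
      have "(\<lambda>k. optical_path \<kappa> (p i) (envelope N p (b k) x *\<^sub>R x) - b k i) \<longlonglongrightarrow>
          optical_path \<kappa> (p i) (envelope N p b' x *\<^sub>R x) - b' i" (is "?f \<longlonglongrightarrow> ?l")
        using i by (intro tendsto_intros envelope_tendsto[OF b x] lim) auto
      moreover have "\<exists>\<^sub>\<infinity>k. ?f k = 0"
        using fr by (rule INFM_mono) (simp add: cell_def)
      ultimately have "?l = 0"
        using tendsto_imp_eventually_ne[of ?f ?l sequentially 0]
        unfolding cofinite_eq_sequentially frequently_def by auto
      then show "x \<in> cell N p b' i" using x by (simp add: cell_def)
    qed
    then show False using e by simp
  qed
next
  show "(\<Sum>i<N. measure M (cell N p (b k) i)) = (\<Sum>i<N. measure M (cell N p b' i))" for k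
    using sum_cells_total[OF b(1) inj] sum_cells_total[OF b(2) inj] by simp
qed (use i in auto)

text \<open>For \<open>x\<close> in the cube, the \<open>i\<close>-th parameter exceeds its value at the anchor by a large multiple of
  the deficit \<open>max x - x\<^sub>i\<close>; so one parameter always has its anchor value. The variational inequality
  is applied to received minus prescribed energy. If \<open>max x < 1\<close>, then no upper face is active and no target
  receives too little. If \<open>max x = 1\<close>, no target receives too much, because a target with
  \<open>x\<^sub>i = 0\<close> has a parameter so large that its cell is empty. Conservation of energy gives equality in
  both cases.\<close>

lemma discrete_refractor:
  assumes N: "0 < N" and p: "\<And>i. i < N \<Longrightarrow> p i \<in> D" and inj: "inj_on p {..<N}"
    and g: "\<And>i. i < N \<Longrightarrow> 0 \<le> g i" "(\<Sum>i<N. g i) = measure M K"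
  shows "\<exists>b. levels N p b \<and> (\<forall>i<N. measure M (cell N p b i) = g i)"
proof -
  obtain R where R: "\<And>P. P \<in> D \<Longrightarrow> norm P \<le> R"
    using compact_imp_bounded[OF D(1)] unfolding bounded_iff by blast
  define lev where "lev x i = anchor_path (p i) + \<kappa> * R * (peak N x - x i)" for x i
  have R0: "0 \<le> R" using R D(2) norm_ge_zero order_trans by (metis all_not_in_conv)
  have adm: "levels N p (lev x)" if x: "\<And>i. i < N \<Longrightarrow> x i \<in> {0..1}" for x
    unfolding levels_def
  proof (intro conjI allI impI)
    show "p i \<in> D" if "i < N" for i by (rule p[OF that])
    show "anchor_path (p i) \<le> lev x i" if "i < N" for i
      using le_peak[OF that, of x] kappa R0 by (simp add: lev_def)
    obtain j where "j < N" "x j = peak N x" using peak_attained[OF N, of x] x by auto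
    then show "\<exists>j<N. lev x j = anchor_path (p j)" by (intro exI[of _ j]) (simp add: lev_def)
  qed
  obtain x where x: "\<And>i. i < N \<Longrightarrow> x i \<in> {0..1::real}"
    and ge: "\<And>i. i < N \<Longrightarrow> x i < 1 \<Longrightarrow> 0 \<le> measure M (cell N p (lev x) i) - g i"
    and le: "\<And>i. i < N \<Longrightarrow> 0 < x i \<Longrightarrow> measure M (cell N p (lev x) i) - g i \<le> 0"
  proof (rule box_variational_inequality[where N = N and F = "\<lambda>x i. measure M (cell N p (lev x) i) - g i"])
    fix X :: "nat \<Rightarrow> nat \<Rightarrow> real" and x i
    assume i: "i < N" and X: "\<And>k j. j < N \<Longrightarrow> X k j \<in> {0..1}" and x: "\<And>j. j < N \<Longrightarrow> x j \<in> {0..1}"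
      and lim: "\<And>j. j < N \<Longrightarrow> (\<lambda>k. X k j) \<longlonglongrightarrow> x j"
    show "(\<lambda>k. measure M (cell N p (lev (X k)) i) - g i) \<longlonglongrightarrow> measure M (cell N p (lev x) i) - g i"
    proof (intro tendsto_diff tendsto_const cell_measure_tendsto[OF _ _ inj _ i] adm X x)
      show "(\<lambda>k. lev (X k) i) \<longlonglongrightarrow> lev x i" if "i < N" for i
        unfolding lev_def by (intro tendsto_intros tendsto_peak lim that)
    qed
  qed blast
  have b: "levels N p (lev x)" by (rule adm[OF x])
  have sum0: "(\<Sum>i<N. measure M (cell N p (lev x) i) - g i) = 0"
    using sum_cells_total[OF b inj] g(2) by (simp add: sum_subtractf)
  have "\<forall>i\<in>{..<N}. measure M (cell N p (lev x) i) - g i = 0"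
  proof (cases "peak N x = 1")
    case True
    have "measure M (cell N p (lev x) i) - g i \<le> 0" if i: "i < N" for i
    proof (cases "x i = 0")
      case xi: True
      have "0 \<le> anchor_path (p i)" unfolding anchor_path_def optical_path_def using kappa by simp
      moreover have "\<kappa> * norm (p i) \<le> \<kappa> * R" using R[OF p[OF i]] kappa by simp
      ultimately have "\<kappa> * norm (p i) \<le> lev x i" by (simp add: lev_def xi True)
      then show ?thesis using cell_empty[OF b i] g(1)[OF i] by simp
    next
      case False
      then show ?thesis using le[OF i] x[OF i] by auto
    qed
    then have "\<forall>i\<in>{..<N}. - (measure M (cell N p (lev x) i) - g i) = 0"
      using sum0 by (subst sum_nonneg_eq_0_iff[symmetric]) (auto simp: sum_subtractf)
    then show ?thesis by simp
  next
    case False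
    have "peak N x \<le> 1" using x by (intro peak_le_1) auto
    then have "x i < 1" if "i < N" for i using le_peak[OF that, of x] False by linarith
    then have "0 \<le> measure M (cell N p (lev x) i) - g i" if "i < N" for i using ge[OF that] that by blast
    then show ?thesis using sum0 by (subst sum_nonneg_eq_0_iff[symmetric]) auto
  qed
  then show ?thesis using b by (intro exI[of _ "lev x"]) auto
qed

end

section \<open>Passage to arbitrary targets\<close>

text \<open>The centers are distinct because sums of energies over cells require distinct targets.\<close>

lemma compact_fine_partition:
  fixes D :: "'a::euclidean_space set"
  assumes D: "compact D" "D \<noteq> {}" and e: "0 < e"
  shows "\<exists>(N::nat) p B. 0 < N \<and> inj_on p {..<N} \<and> p ` {..<N} \<subseteq> D \<and>
    (\<forall>i. B i \<in> sets borel \<and> B i \<subseteq> ball (p i) e) \<and> disjoint_family_on B {..<N} \<and> (\<Union>i<N. B i) = D"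
proof -
  obtain C where C: "C \<subseteq> D" "finite C" "D \<subseteq> (\<Union>c\<in>C. ball c e)"
    using compactE_image[OF D(1), of D "\<lambda>c. ball c e"] e
    by (metis (no_types, lifting) UN_iff centre_in_ball open_ball subsetI)
  obtain p where p: "bij_betw p {0..<card C} C" using ex_bij_betw_nat_finite[OF C(2)] by blast
  define B where "B i = D \<inter> ball (p i) e - (\<Union>j<i. ball (p j) e)" for i
  have "C \<noteq> {}" using C D by auto
  then have 1: "0 < card C" using C(2) by (simp add: card_gt_0_iff)
  have 2: "inj_on p {..<card C}" using p by (simp add: bij_betw_def lessThan_atLeast0)
  have 3: "p i \<in> D" if "i < card C" for i using p C that by (auto simp: bij_betw_def)
  have 4: "B i \<in> sets borel" for i
    unfolding B_def using compact_imp_closed[OF D(1)] by (intro sets.Diff sets.Int sets.finite_UN) auto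
  have 5: "disjoint_family_on B {..<card C}"
    unfolding disjoint_family_on_def
  proof (intro ballI impI)
    fix i j :: nat assume "i \<noteq> j"
    then show "B i \<inter> B j = {}" unfolding B_def by (cases "i < j") auto
  qed
  have 6: "D \<subseteq> (\<Union>i<card C. B i)"
  proof
    fix P assume P: "P \<in> D"
    then obtain c where "c \<in> C" "P \<in> ball c e" using C(3) by blast
    then obtain i0 where i0: "i0 < card C" "P \<in> ball (p i0) e"
      using bij_betw_imp_surj_on[OF p] by (metis atLeastLessThan_iff imageE)
    define i where "i = (LEAST i. P \<in> ball (p i) e)"
    have i: "P \<in> ball (p i) e" unfolding i_def by (rule LeastI[of _ i0]) (rule i0(2))
    have "i \<le> i0" unfolding i_def by (rule Least_le) (rule i0(2))
    moreover have "P \<notin> ball (p j) e" if "j < i" for j using not_less_Least that unfolding i_def by blast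
    ultimately show "P \<in> (\<Union>i<card C. B i)" using i i0(1) P unfolding B_def by fastforce
  qed
  have 7: "B i \<subseteq> ball (p i) e" for i unfolding B_def by auto
  have "(\<Union>i<card C. B i) \<subseteq> D" unfolding B_def by auto
  then have 8: "(\<Union>i<card C. B i) = D" using 6 by (rule antisym)
  have "p ` {..<card C} \<subseteq> D" using 3 by auto
  then show ?thesis using 1 2 4 5 7 8 by (intro exI conjI allI)
qed

context refraction
begin

text \<open>The approximate contact point \<open>P\<close> need not lie in \<open>F\<close>; its distance from \<open>F\<close> is controlled and tends to
  zero.\<close>

lemma touches_limit_compact:
  assumes F: "compact F" and y: "y \<in> K"
    and e: "e \<longlonglongrightarrow> 0" and \<rho>: "\<And>x. x \<in> K \<Longrightarrow> (\<lambda>k. \<rho> k x) \<longlonglongrightarrow> \<rho>' x"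
    and freq: "\<exists>\<^sub>\<infinity>k. \<exists>P. \<exists>Q\<in>F. dist P Q \<le> e k \<and> touches \<kappa> K (\<rho> k) P y"
  shows "\<exists>P\<in>F. touches \<kappa> K \<rho>' P y"
proof -
  define good where "good k P Q \<longleftrightarrow> Q \<in> F \<and> dist P Q \<le> e k \<and> touches \<kappa> K (\<rho> k) P y" for k P Q
  have inf: "infinite {k. \<exists>P Q. good k P Q}"
    using freq unfolding INFM_iff_infinite good_def Bex_def
    by (simp add: conj_assoc)
  obtain r where r: "strict_mono (r :: nat \<Rightarrow> nat)" "\<forall>n. r n \<in> {k. \<exists>P Q. good k P Q}"
    using infinite_enumerate[OF inf] by (elim exE conjE)
  have "\<exists>P Q. good (r n) P Q" for n using r(2) by simp
  then obtain P Q where PQ: "\<And>n. good (r n) (P n) (Q n)" by metis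
  have QF: "\<forall>n. Q n \<in> F" using PQ unfolding good_def by blast
  obtain l s where l: "l \<in> F" and s: "strict_mono (s :: nat \<Rightarrow> nat)" and lim: "(Q \<circ> s) \<longlonglongrightarrow> l"
    using seq_compactE[OF compact_imp_seq_compact[OF F] QF] by metis
  have rs: "strict_mono (r \<circ> s)" by (rule strict_mono_o[OF r(1) s])
  have "(\<lambda>n. dist (P (s n)) (Q (s n))) \<longlonglongrightarrow> 0"
  proof (rule tendsto_sandwich[OF _ _ tendsto_const LIMSEQ_subseq_LIMSEQ[OF e rs]])
    show "\<forall>\<^sub>F n in sequentially. dist (P (s n)) (Q (s n)) \<le> (e \<circ> (r \<circ> s)) n"
      using PQ unfolding good_def by (intro always_eventually allI) simp
  qed simp
  moreover have "(\<lambda>n. Q (s n)) \<longlonglongrightarrow> l" using lim unfolding o_def .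
  ultimately have P: "(\<lambda>n. P (s n)) \<longlonglongrightarrow> l"
    using Lim_transform[of "\<lambda>n. Q (s n)" l sequentially "\<lambda>n. P (s n)"]
    by (simp add: dist_norm norm_minus_commute tendsto_norm_zero_iff)
  have \<rho>rs: "(\<lambda>n. \<rho> (r (s n)) x) \<longlonglongrightarrow> \<rho>' x" if "x \<in> K" for x
    using LIMSEQ_subseq_LIMSEQ[OF \<rho>[OF that] rs] unfolding o_def .
  have t: "touches \<kappa> K (\<rho> (r (s n))) (P (s n)) y" for n using PQ unfolding good_def by blast
  have "touches \<kappa> K \<rho>' l y"
    by (rule touches_limit[OF t P tendsto_const \<rho>rs \<rho>rs[OF y]])
  then show ?thesis using l by blast
qed

end

context visible_refractor
begin

lemma preimage_Un_compl: "preimage B \<union> preimage (- B) = K"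
  using touched unfolding preimage_def by blast

lemma preimage_Int_compl: "preimage B \<inter> preimage (- B) \<subseteq> ambiguous"
proof
  fix y assume y: "y \<in> preimage B \<inter> preimage (- B)"
  then obtain P P' where P: "P \<in> D" "P \<in> B" "touches \<kappa> K \<rho> P y" "P' \<in> D" "P' \<notin> B" "touches \<kappa> K \<rho> P' y"
    unfolding preimage_def by auto
  then have "P \<noteq> P'" by auto
  then show "y \<in> ambiguous" using y P unfolding preimage_def ambiguous_def by auto
qed

lemma preimage_mono: "A \<subseteq> B \<Longrightarrow> preimage A \<subseteq> preimage B"
  unfolding preimage_def by blast

end

context anchored_refraction
begin

text \<open>The oval that touches at the anchor starts from the optical path \<open>\<kappa> |P|\<close> at the source and has lost at
  least \<open>\<delta> t0\<close> at the anchor. At radius \<open>\<rho> x\<close> at least as much must be lost, and the optical path has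
  Lipschitz constant \<open>1 + \<kappa>\<close>. The bound keeps limits of refractors away from the source.\<close>

lemma radius_lower_bound:
  assumes R: "refractor \<kappa> \<delta> r0 K D \<rho>" and \<rho>: "\<rho> z = t0" and x: "x \<in> K"
  shows "\<delta> * t0 / (1 + \<kappa>) \<le> \<rho> x"
proof -
  interpret refractor \<kappa> \<delta> r0 K D \<rho> by (rule R)
  obtain P where P: "P \<in> D" "touches \<kappa> K \<rho> P z" using touched[OF anchor(1)] by auto
  have "\<delta> * t0 \<le> optical_path \<kappa> P (0 *\<^sub>R z) - optical_path \<kappa> P (t0 *\<^sub>R z)"
    using optical_path_decrease[OF anchor(1) P(1), of 0 t0] anchor by simp
  also have "\<dots> \<le> optical_path \<kappa> P 0 - optical_path \<kappa> P (\<rho> x *\<^sub>R x)"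
    using P(2) x \<rho> unfolding touches_def by simp
  also have "\<dots> \<le> (1 + \<kappa>) * norm (0 - \<rho> x *\<^sub>R x)"
    using optical_path_lipschitz[of \<kappa> P 0 "\<rho> x *\<^sub>R x"] kappa by linarith
  also have "norm (0 - \<rho> x *\<^sub>R x) = \<rho> x" using radius[OF x] x by simp
  finally show ?thesis using kappa by (simp add: field_simps)
qed

lemma refractor_limit:
  assumes R: "\<And>k. visible_refractor \<kappa> \<delta> r0 K D (\<rho> k)" and anc: "\<And>k. \<rho> k z = t0"
    and lim: "\<And>x. x \<in> K \<Longrightarrow> (\<lambda>k. \<rho> k x) \<longlonglongrightarrow> \<rho>' x"
  shows "visible_refractor \<kappa> \<delta> r0 K D \<rho>'"
proof -
  have R': "refractor \<kappa> \<delta> r0 K D (\<rho> k)" for k using R visible_refractor.axioms(1) by blast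
  have "refractor \<kappa> \<delta> r0 K D \<rho>'"
  proof unfold_locales
    fix x assume x: "x \<in> K"
    have "\<delta> * t0 / (1 + \<kappa>) \<le> \<rho>' x"
      by (rule LIMSEQ_le_const[OF lim[OF x]]) (use radius_lower_bound[OF R' anc x] in blast)
    moreover have "0 < \<delta> * t0 / (1 + \<kappa>)" using delta anchor(2) kappa by simp
    moreover have "\<rho>' x \<le> r0"
      by (rule LIMSEQ_le_const2[OF lim[OF x]]) (use refractor.radius[OF R' x] in blast)
    ultimately show "0 < \<rho>' x \<and> \<rho>' x \<le> r0" by linarith
  next
    fix y assume y: "y \<in> K"
    have "\<exists>P. \<exists>Q\<in>D. dist P Q \<le> 0 \<and> touches \<kappa> K (\<rho> k) P y" for k
      using refractor.touched[OF R' y, of k] by auto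
    then show "\<exists>P\<in>D. touches \<kappa> K \<rho>' P y"
      by (intro touches_limit_compact[OF D(1) y _ lim, of "\<lambda>_. 0"]) auto
  qed
  then show ?thesis by (intro visible_refractor.intro visible_refraction_axioms)
qed

lemma refractor_subsequence:
  assumes R: "\<And>k. visible_refractor \<kappa> \<delta> r0 K D (\<rho> k)"
  obtains \<rho>' r where "strict_mono (r :: nat \<Rightarrow> nat)" "\<And>x. x \<in> K \<Longrightarrow> (\<lambda>k. \<rho> (r k) x) \<longlonglongrightarrow> \<rho>' x"
proof -
  have R': "refractor \<kappa> \<delta> r0 K D (\<rho> k)" for k using R visible_refractor.axioms(1) by blast
  define L where "L = (1 + \<kappa>) * r0 / \<delta>"
  have L: "0 < L" using kappa r0 delta by (simp add: L_def)
  have equi: "\<exists>d>0. \<forall>n y. y \<in> K \<and> norm (x - y) < d \<longrightarrow> norm (\<rho> n x - \<rho> n y) < e"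
    if x: "x \<in> K" and e: "0 < e" for x e
  proof (intro exI[of _ "e / L"] conjI allI impI)
    show "0 < e / L" using e L by simp
    fix n y assume y: "y \<in> K \<and> norm (x - y) < e / L"
    have "norm (\<rho> n x - \<rho> n y) \<le> L * norm (x - y)"
      using refractor.radius_lipschitz[OF R' x, of y n] y unfolding L_def by simp
    also have "\<dots> < e" using y L by (simp add: field_simps)
    finally show "norm (\<rho> n x - \<rho> n y) < e" .
  qed
  have bnd: "norm (\<rho> n x) \<le> r0" if "x \<in> K" for n x using refractor.radius[OF R' that, of n] by simp
  obtain g r where "continuous_on K g" and r: "strict_mono (r :: nat \<Rightarrow> nat)"
    and unif: "\<And>e. 0 < e \<Longrightarrow> \<exists>N. \<forall>n x. n \<ge> N \<and> x \<in> K \<longrightarrow> norm (\<rho> (r n) x - g x) < e"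
    using Arzela_Ascoli[OF K(1) bnd equi] by blast
  show ?thesis
  proof (rule that[OF r])
    fix x assume x: "x \<in> K"
    show "(\<lambda>k. \<rho> (r k) x) \<longlonglongrightarrow> g x"
      by (rule LIMSEQ_I) (use unif x in blast)
  qed
qed

end

context emitting_refraction
begin

text \<open>Preimages commute with unions, and with complements up to ambiguous directions.\<close>

lemma preimage_sets:
  assumes R: "visible_refractor \<kappa> \<delta> r0 K D \<rho>" and B: "B \<in> sets borel"
  shows "refractor.preimage \<kappa> K D \<rho> B \<in> sets M"
proof -
  interpret R: visible_refractor \<kappa> \<delta> r0 K D \<rho> by (rule R)
  have "B \<in> sigma_sets UNIV (Collect closed)"
    using B unfolding borel_eq_closed by simp
  then show ?thesis
  proof induction
    case (Basic F)
    then have "compact (R.preimage F)" by (intro R.compact_preimage) simp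
    then show ?case by (intro borel_sets borel_compact) (auto simp: R.preimage_def)
  next
    case Empty
    then show ?case by (simp add: R.preimage_def)
  next
    case (Compl B)
    have KM: "K \<in> sets M" using K(1) by (intro borel_sets borel_compact) auto
    have "R.preimage B \<inter> R.preimage (- B) \<in> null_sets M"
      by (rule ambiguous_null[OF R R.preimage_Int_compl])
    then have "(K - R.preimage B) \<union> (R.preimage B \<inter> R.preimage (- B)) \<in> sets M"
      using Compl KM by auto
    moreover have "R.preimage (UNIV - B) = (K - R.preimage B) \<union> (R.preimage B \<inter> R.preimage (- B))"
      using R.preimage_Un_compl[of B] unfolding Compl_eq_Diff_UNIV[symmetric]
      by (auto simp: R.preimage_def)
    ultimately show ?case by simp
  next
    case (Union B)
    have "R.preimage (\<Union>i. B i) = (\<Union>i. R.preimage (B i))" unfolding R.preimage_def by blast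
    then show ?case using Union by auto
  qed
qed

text \<open>The mass of each small piece of \<open>D\<close> is moved to its center. A piece that meets \<open>F\<close> has its center within
  distance \<open>e\<close> of \<open>F\<close>.\<close>

lemma approximate_solution:
  assumes mu: "finite_measure \<mu>" "sets \<mu> = sets (restrict_space borel D)" "measure \<mu> D = measure M K"
    and e: "0 < e"
  shows "\<exists>\<rho>. visible_refractor \<kappa> \<delta> r0 K D \<rho> \<and> \<rho> z = t0 \<and>
    (\<forall>F. closed F \<and> F \<subseteq> D \<longrightarrow> (\<exists>E\<in>sets M.
       E \<subseteq> {y \<in> K. \<exists>P. \<exists>Q\<in>F. dist P Q \<le> e \<and> touches \<kappa> K \<rho> P y} \<and> measure \<mu> F \<le> measure M E))"
proof -
  interpret \<mu>: finite_measure \<mu> by (rule mu(1))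
  obtain N :: nat and p B where NpB: "0 < N \<and> inj_on p {..<N} \<and> p ` {..<N} \<subseteq> D \<and>
    (\<forall>i. B i \<in> sets borel \<and> B i \<subseteq> ball (p i) e) \<and> disjoint_family_on B {..<N} \<and> (\<Union>i<N. B i) = D"
    using compact_fine_partition[OF D e] by (elim exE)
  then have N: "0 < N" and inj: "inj_on p {..<N}" and disj: "disjoint_family_on B {..<N}"
    and cover: "(\<Union>i<N. B i) = D" by simp_all
  have p: "p i \<in> D" if "i < N" for i using NpB that by auto
  have Bb: "B i \<in> sets borel" and Bball: "B i \<subseteq> ball (p i) e" for i using NpB by simp_all
  have Ds: "D \<in> sets borel" using compact_imp_closed[OF D(1)] by auto
  have mus: "S \<in> sets \<mu>" if "S \<in> sets borel" "S \<subseteq> D" for S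
    unfolding mu(2) using that Ds by (subst sets_restrict_space_iff) auto
  have Bs: "B i \<in> sets \<mu>" if "i < N" for i
    using cover that by (intro mus Bb) auto
  have sumB: "(\<Sum>i\<in>I. measure \<mu> (B i)) = measure \<mu> (\<Union>i\<in>I. B i)" if I: "I \<subseteq> {..<N}" for I
    using I Bs disj by (intro \<mu>.finite_measure_finite_Union[symmetric])
      (auto intro: finite_subset disjoint_family_on_mono)
  have "(\<Sum>i<N. measure \<mu> (B i)) = measure M K" using sumB[of "{..<N}"] cover mu(3) by simp
  then obtain b where b: "levels N p b" and cell: "\<And>i. i < N \<Longrightarrow> measure M (cell N p b i) = measure \<mu> (B i)"
    using discrete_refractor[OF N p inj, of "\<lambda>i. measure \<mu> (B i)"] by auto
  show ?thesis
  proof (intro exI[of _ "envelope N p b"] conjI allI impI envelope_refractor[OF b] envelope_anchor[OF b])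
    fix F assume F: "closed F \<and> F \<subseteq> D"
    define I where "I = {i. i < N \<and> B i \<inter> F \<noteq> {}}"
    have I: "I \<subseteq> {..<N}" unfolding I_def by auto
    define E where "E = (\<Union>i\<in>I. cell N p b i)"
    have "measure \<mu> F \<le> measure \<mu> (\<Union>i\<in>I. B i)"
    proof (rule \<mu>.finite_measure_mono)
      show "F \<subseteq> (\<Union>i\<in>I. B i)" using F cover unfolding I_def by blast
      show "(\<Union>i\<in>I. B i) \<in> sets \<mu>" using Bs I by (intro sets.finite_UN) (auto intro: finite_subset)
    qed
    also have "\<dots> = (\<Sum>i\<in>I. measure M (cell N p b i))"
      unfolding sumB[OF I, symmetric] using I by (intro sum.cong) (auto simp: cell)
    also have "\<dots> = measure M E" unfolding E_def by (rule sum_cells[OF b inj I])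
    finally have le: "measure \<mu> F \<le> measure M E" .
    have Es: "E \<in> sets M" unfolding E_def using cell_sets[OF b] I
      by (intro sets.finite_UN) (auto intro: finite_subset)
    have "E \<subseteq> {y \<in> K. \<exists>P. \<exists>Q\<in>F. dist P Q \<le> e \<and> touches \<kappa> K (envelope N p b) P y}"
    proof
      fix y assume "y \<in> E"
      then obtain i where i: "i < N" "B i \<inter> F \<noteq> {}" and y: "y \<in> cell N p b i"
        unfolding E_def I_def by auto
      obtain Q where Q: "Q \<in> F" "dist (p i) Q \<le> e" using i(2) Bball[of i] by fastforce
      have "touches \<kappa> K (envelope N p b) (p i) y" "y \<in> K"
        using y active_touches[OF b _ i(1)] unfolding cell_def by auto
      then show "y \<in> {y \<in> K. \<exists>P. \<exists>Q\<in>F. dist P Q \<le> e \<and> touches \<kappa> K (envelope N p b) P y}"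
        using Q by blast
    qed
    then show "\<exists>E\<in>sets M. E \<subseteq> {y \<in> K. \<exists>P. \<exists>Q\<in>F. dist P Q \<le> e \<and> touches \<kappa> K (envelope N p b) P y} \<and>
        measure \<mu> F \<le> measure M E"
      using le Es by blast
  qed
qed

lemma weak_refractor_exists:
  assumes mu: "finite_measure \<mu>" "sets \<mu> = sets (restrict_space borel D)" "measure \<mu> D = measure M K"
    and inner: "\<And>B. B \<in> sets \<mu> \<Longrightarrow> emeasure \<mu> B = (SUP C\<in>{C. compact C \<and> C \<subseteq> B}. emeasure \<mu> C)"
  shows "\<exists>\<rho>. visible_refractor \<kappa> \<delta> r0 K D \<rho> \<and> \<rho> z = t0 \<and>
    (\<forall>B\<in>sets borel. B \<subseteq> D \<longrightarrow> emeasure \<mu> B = emeasure M (refractor.preimage \<kappa> K D \<rho> B))"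
proof -
  interpret \<mu>: finite_measure \<mu> by (rule mu(1))
  define ok where "ok e \<rho> \<longleftrightarrow> visible_refractor \<kappa> \<delta> r0 K D \<rho> \<and> \<rho> z = t0 \<and>
    (\<forall>F. closed F \<and> F \<subseteq> D \<longrightarrow> (\<exists>E\<in>sets M.
       E \<subseteq> {y \<in> K. \<exists>P. \<exists>Q\<in>F. dist P Q \<le> e \<and> touches \<kappa> K \<rho> P y} \<and> measure \<mu> F \<le> measure M E))" for e \<rho>
  have "\<exists>\<rho>. ok (1 / real (Suc k)) \<rho>" for k
    unfolding ok_def by (rule approximate_solution[OF mu]) simp
  then obtain \<rho>s where \<rho>s: "\<And>k. ok (1 / real (Suc k)) (\<rho>s k)" by metis
  have Rs: "visible_refractor \<kappa> \<delta> r0 K D (\<rho>s k)" for k using \<rho>s unfolding ok_def by blast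
  obtain \<rho> r where r: "strict_mono (r :: nat \<Rightarrow> nat)" and lim: "\<And>x. x \<in> K \<Longrightarrow> (\<lambda>k. \<rho>s (r k) x) \<longlonglongrightarrow> \<rho> x"
    by (rule refractor_subsequence[of \<rho>s, OF Rs]) (rule that)
  define e where "e k = 1 / real (Suc (r k))" for k
  have e0: "e \<longlonglongrightarrow> 0"
    using LIMSEQ_subseq_LIMSEQ[OF LIMSEQ_inverse_real_of_nat r]
    unfolding e_def by (simp add: o_def inverse_eq_divide)
  have ok: "ok (e k) (\<rho>s (r k))" for k unfolding e_def by (rule \<rho>s)
  have anc: "\<rho>s (r k) z = t0" for k using ok unfolding ok_def by blast
  have R: "visible_refractor \<kappa> \<delta> r0 K D \<rho>" by (rule refractor_limit[OF Rs anc lim])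
  interpret R: visible_refractor \<kappa> \<delta> r0 K D \<rho> by (rule R)
  have \<rho>z: "\<rho> z = t0"
    using lim[OF anchor(1)] LIMSEQ_unique tendsto_const unfolding anc by blast
  have closed_le: "measure \<mu> F \<le> measure M (R.preimage F)" if F: "closed F" "F \<subseteq> D" for F
  proof -
    define Y where "Y k = {y \<in> K. \<exists>P. \<exists>Q\<in>F. dist P Q \<le> e k \<and> touches \<kappa> K (\<rho>s (r k)) P y}" for k
    have "\<exists>E. E \<in> sets M \<and> E \<subseteq> Y k \<and> measure \<mu> F \<le> measure M E" for k
      using ok[of k] F unfolding ok_def Y_def by blast
    then have "\<exists>E. \<forall>k. E k \<in> sets M \<and> E k \<subseteq> Y k \<and> measure \<mu> F \<le> measure M (E k)"
      by (intro choice allI)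
    then obtain E where E_all: "\<forall>k. E k \<in> sets M \<and> E k \<subseteq> Y k \<and> measure \<mu> F \<le> measure M (E k)" ..
    have E: "E k \<in> sets M" "measure \<mu> F \<le> measure M (E k)" "E k \<subseteq> Y k" for k using E_all by simp_all
    have cF: "compact F" using compact_Int_closed[OF D(1) F(1)] F(2) by (simp add: Int_absorb1)
    show ?thesis
    proof (rule measure_limsup_ge[where E = E])
      show "R.preimage F \<in> sets M" using F by (intro preimage_sets[OF R]) auto
      show "\<exists>\<^sub>\<infinity>k. measure \<mu> F \<le> measure M (E k)" using E(2) by (auto simp: INFM_nat)
      fix y assume fr: "\<exists>\<^sub>\<infinity>k. y \<in> E k"
      then obtain k where "y \<in> E k" by (metis INFM_EX)
      then have "y \<in> Y k" using E(3) by (rule rev_subsetD)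
      then have y: "y \<in> K" by (simp add: Y_def)
      have fr': "\<exists>\<^sub>\<infinity>k. \<exists>P. \<exists>Q\<in>F. dist P Q \<le> e k \<and> touches \<kappa> K (\<rho>s (r k)) P y"
        using fr
      proof (rule INFM_mono)
        fix k assume "y \<in> E k"
        then have "y \<in> Y k" using E(3) by (rule rev_subsetD)
        then show "\<exists>P. \<exists>Q\<in>F. dist P Q \<le> e k \<and> touches \<kappa> K (\<rho>s (r k)) P y" by (simp add: Y_def)
      qed
      have "\<exists>P\<in>F. touches \<kappa> K \<rho> P y"
        by (rule touches_limit_compact[OF cF y e0 _ fr']) (rule lim)
      then show "y \<in> R.preimage F" using y F(2) unfolding R.preimage_def by blast
    qed (rule E(1))
  qed
  have Ds: "D \<in> sets borel" using compact_imp_closed[OF D(1)] by auto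
  have mus: "S \<in> sets \<mu>" if "S \<in> sets borel" "S \<subseteq> D" for S
    unfolding mu(2) using that Ds by (subst sets_restrict_space_iff) auto
  have le: "measure \<mu> B \<le> measure M (R.preimage B)" if B: "B \<in> sets borel" "B \<subseteq> D" for B
  proof -
    have "emeasure \<mu> B \<le> emeasure M (R.preimage B)"
      unfolding inner[OF mus[OF B]]
    proof (rule SUP_least)
      fix C assume "C \<in> {C. compact C \<and> C \<subseteq> B}"
      then have C: "compact C" "C \<subseteq> B" by auto
      have "emeasure \<mu> C \<le> emeasure M (R.preimage C)"
        using closed_le[of C] C B compact_imp_closed[OF C(1)]
        by (simp add: emeasure_eq_measure \<mu>.emeasure_eq_measure)
      also have "\<dots> \<le> emeasure M (R.preimage B)"
        using R.preimage_mono[OF C(2)] by (rule emeasure_mono) (rule preimage_sets[OF R B(1)])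
      finally show "emeasure \<mu> C \<le> emeasure M (R.preimage B)" .
    qed
    then show ?thesis by (simp add: emeasure_eq_measure \<mu>.emeasure_eq_measure)
  qed
  have "emeasure \<mu> B = emeasure M (R.preimage B)" if B: "B \<in> sets borel" "B \<subseteq> D" for B
  proof -
    have DB: "D - B \<in> sets borel" "D - B \<subseteq> D" using B Ds by auto
    have pc: "R.preimage (D - B) = R.preimage (- B)" unfolding R.preimage_def by blast
    have s: "R.preimage B \<in> sets M" "R.preimage (- B) \<in> sets M"
      using preimage_sets[OF R B(1)] preimage_sets[OF R DB(1)] pc by auto
    have "measure M K = measure M (R.preimage B \<union> R.preimage (- B))" by (simp add: R.preimage_Un_compl)
    also have "\<dots> = measure M (R.preimage B) + measure M (R.preimage (- B) - R.preimage B)"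
      using finite_measure_Union[OF s(1), of "R.preimage (- B) - R.preimage B"] s by simp
    also have "R.preimage (- B) - R.preimage B = R.preimage (- B) - (R.preimage B \<inter> R.preimage (- B))" by auto
    also have "measure M \<dots> = measure M (R.preimage (- B))"
      by (intro measure_Diff_null_set s ambiguous_null[OF R R.preimage_Int_compl])
    finally have 1: "measure M K = measure M (R.preimage B) + measure M (R.preimage (D - B))" unfolding pc .
    have "measure \<mu> D = measure \<mu> B + measure \<mu> (D - B)"
      using \<mu>.finite_measure_Union[of B "D - B"] mus B DB by (simp add: Un_absorb1)
    then have "measure \<mu> B = measure M (R.preimage B)"
      using 1 le[OF B] le[OF DB] mu(3) by linarith
    then show ?thesis by (simp add: emeasure_eq_measure \<mu>.emeasure_eq_measure)
  qed
  then show ?thesis using R \<rho>z by blast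
qed

end

section \<open>The size conditions on the surface\<close>

text \<open>In units of \<open>|P|\<close>, with \<open>c\<close> the cosine of the angle and \<open>u\<close> the distance, the claim squares to
  \<open>(\<kappa>\<^sup>2 - 1) (c - u)\<^sup>2 + c\<^sup>2 > 1\<close>. Its left side grows with \<open>c > u\<close>, so the smallest admissible value
  \<open>c = 1 / \<kappa> + \<tau>\<close> decides. With \<open>q = \<kappa> \<tau> / (\<kappa> - 1)\<close>, which lies in \<open>(0, 1)\<close>, the bound on
  \<open>t\<close> reads \<open>u < q\<^sup>2 / 4\<close> and \<open>\<kappa> c = 1 + q (\<kappa> - 1)\<close>.\<close>

lemma steep_of_angle:
  fixes x P :: "'a::euclidean_space"
  assumes \<kappa>: "1 < \<kappa>" and \<tau>: "0 < \<tau>" "\<tau> < 1 - 1 / \<kappa>" and x: "norm x = 1" and P: "P \<noteq> 0"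
    and angle: "(1 / \<kappa> + \<tau>) * norm P \<le> x \<bullet> P"
    and t: "0 \<le> t" "t < \<kappa>\<^sup>2 * \<tau>\<^sup>2 / (4 * (\<kappa> - 1)\<^sup>2) * norm P"
  shows "norm (P - t *\<^sub>R x) < \<kappa> * (x \<bullet> P - t)"
proof -
  define q where "q = \<kappa> * \<tau> / (\<kappa> - 1)"
  define p where "p = norm P"
  define c where "c = (x \<bullet> P) / p"
  define u where "u = t / p"
  define w where "w = 1 + q * (\<kappa> - 1)"
  have p: "p > 0" using P by (simp add: p_def)
  have q: "0 < q" "q < 1" using \<kappa> \<tau> by (auto simp: q_def field_simps)
  have tq: "t < q\<^sup>2 / 4 * p" using t(2) by (simp add: q_def p_def power_divide power_mult_distrib mult.commute)
  have u: "0 \<le> u" "u < q\<^sup>2 / 4" using t(1) tq p by (auto simp: u_def field_simps)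
  have \<tau>q: "\<tau> = q * (\<kappa> - 1) / \<kappa>" using \<kappa> by (simp add: q_def)
  have w\<kappa>: "w / \<kappa> = 1 / \<kappa> + \<tau>" unfolding w_def \<tau>q by (simp add: add_divide_distrib)
  have c: "w / \<kappa> \<le> c" unfolding w\<kappa> using angle p by (simp add: c_def p_def field_simps)
  have w1: "1 < w" using q \<kappa> by (simp add: w_def)
  have "w / \<kappa> = q + (1 - q) / \<kappa>" using \<kappa> by (simp add: w_def field_simps)
  then have "q < w / \<kappa>" using q \<kappa> by simp
  moreover have "q\<^sup>2 / 4 < q" using q by (simp add: power2_eq_square)
  ultimately have uw: "u < w / \<kappa>" using u by linarith
  have "2 * (\<kappa>\<^sup>2 - 1) * (w / \<kappa>) * u \<le> (\<kappa> - 1) * (4 * w) * u"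
  proof -
    have "(\<kappa>\<^sup>2 - 1) / \<kappa> = (\<kappa> - 1) * (1 + 1 / \<kappa>)" using \<kappa> by (simp add: field_simps power2_eq_square)
    also have "\<dots> \<le> (\<kappa> - 1) * 2" using \<kappa> by (intro mult_left_mono) auto
    finally have "(\<kappa>\<^sup>2 - 1) / \<kappa> * (2 * w * u) \<le> (\<kappa> - 1) * 2 * (2 * w * u)"
      using w1 u(1) by (intro mult_right_mono) auto
    moreover have "(\<kappa>\<^sup>2 - 1) / \<kappa> * (2 * w * u) = 2 * (\<kappa>\<^sup>2 - 1) * (w / \<kappa>) * u" by simp
    moreover have "(\<kappa> - 1) * 2 * (2 * w * u) = (\<kappa> - 1) * (4 * w) * u" by simp
    ultimately show ?thesis by linarith
  qed
  also have "\<dots> \<le> (\<kappa> - 1) * (w * q\<^sup>2)"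
    using u w1 \<kappa> mult_left_mono[of "4 * u" "q\<^sup>2" "(\<kappa> - 1) * w"] by (simp add: algebra_simps)
  also have "\<dots> < (\<kappa> - 1) * (q * (2 + q * (\<kappa> - 1)))"
  proof (rule mult_strict_left_mono)
    have "q * w \<le> w" using q w1 by simp
    then have "q * w < 2 + q * (\<kappa> - 1)" unfolding w_def by simp
    then have "q * (q * w) < q * (2 + q * (\<kappa> - 1))" using q by (intro mult_strict_left_mono)
    then show "w * q\<^sup>2 < q * (2 + q * (\<kappa> - 1))" by (simp add: power2_eq_square mult.assoc mult.left_commute mult.commute)
  qed (use \<kappa> in simp)
  also have "\<dots> = w\<^sup>2 - 1" unfolding w_def by (simp add: power2_eq_square algebra_simps)
  finally have 1: "2 * (\<kappa>\<^sup>2 - 1) * (w / \<kappa>) * u < w\<^sup>2 - 1" .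
  have k2: "\<kappa>\<^sup>2 - 1 > 0" using \<kappa> by simp
  have "(\<kappa>\<^sup>2 - 1) * (w / \<kappa> - u)\<^sup>2 + (w / \<kappa>)\<^sup>2 - 1
      = (w\<^sup>2 - 1) - 2 * (\<kappa>\<^sup>2 - 1) * (w / \<kappa>) * u + (\<kappa>\<^sup>2 - 1) * u\<^sup>2"
    using \<kappa> by (simp add: power2_eq_square field_simps)
  also have "\<dots> > 0" using 1 k2 by (smt (verit) mult_nonneg_nonneg zero_le_power2)
  also have "(\<kappa>\<^sup>2 - 1) * (w / \<kappa> - u)\<^sup>2 + (w / \<kappa>)\<^sup>2 - 1 \<le> (\<kappa>\<^sup>2 - 1) * (c - u)\<^sup>2 + c\<^sup>2 - 1"
    using c uw u k2 by (intro diff_right_mono add_mono mult_left_mono power_mono) auto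
  finally have "1 - 2 * u * c + u\<^sup>2 < (\<kappa> * (c - u))\<^sup>2"
    by (simp add: power2_eq_square algebra_simps)
  then have "p\<^sup>2 * (1 - 2 * u * c + u\<^sup>2) < p\<^sup>2 * (\<kappa> * (c - u))\<^sup>2" using p by simp
  moreover have "p\<^sup>2 * (1 - 2 * u * c + u\<^sup>2) = (norm (P - t *\<^sub>R x))\<^sup>2"
    unfolding norm_diff_ray_sq[OF x] p_def[symmetric] using p
    by (simp add: u_def c_def power2_eq_square field_simps)
  moreover have "p\<^sup>2 * (\<kappa> * (c - u))\<^sup>2 = (\<kappa> * (x \<bullet> P - t))\<^sup>2"
    using p by (simp add: u_def c_def power2_eq_square field_simps)
  ultimately have "(norm (P - t *\<^sub>R x))\<^sup>2 < (\<kappa> * (x \<bullet> P - t))\<^sup>2" by simp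
  moreover have "0 \<le> \<kappa> * (x \<bullet> P - t)"
  proof -
    have "p * u \<le> p * c" using uw c p by (intro mult_left_mono) auto
    then show ?thesis using p \<kappa> by (simp add: u_def c_def)
  qed
  ultimately show ?thesis by (rule power2_less_imp_less)
qed

text \<open>The triangle inequality bounds the optical path at \<open>X\<close> below by \<open>\<kappa> |P| - (\<kappa> - 1) |X|\<close>. In direction
  \<open>x\<close>, the optical path has dropped from \<open>\<kappa> |P|\<close> by at least \<open>(3 / 4) q (\<kappa> - 1) r\<close> at distance
  \<open>r\<close>, where \<open>q = \<kappa> \<tau> / (\<kappa> - 1)\<close> as before.\<close>

lemma optical_path_at_far_end:
  fixes x P X :: "'a::euclidean_space"
  assumes \<kappa>: "1 < \<kappa>" and \<tau>: "0 < \<tau>" "\<tau> < 1 - 1 / \<kappa>" and x: "norm x = 1" and P: "P \<noteq> 0"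
    and angle: "(1 / \<kappa> + \<tau>) * norm P \<le> x \<bullet> P"
    and r: "0 \<le> r" "r < \<kappa>\<^sup>2 * \<tau>\<^sup>2 / (4 * (\<kappa> - 1)\<^sup>2) * norm P"
    and X: "norm X \<le> 3 / 4 * (\<kappa> * \<tau> / (\<kappa> - 1)) * r"
  shows "optical_path \<kappa> P (r *\<^sub>R x) \<le> optical_path \<kappa> P X"
proof -
  define q where "q = \<kappa> * \<tau> / (\<kappa> - 1)"
  define p where "p = norm P"
  define v where "v = 1 + 3 / 4 * q * (\<kappa> - 1)"
  have p: "p > 0" using P by (simp add: p_def)
  have q: "0 < q" "q < 1" using \<kappa> \<tau> by (auto simp: q_def field_simps)
  have rq: "r < q\<^sup>2 / 4 * p" using r(2) by (simp add: q_def p_def power_divide power_mult_distrib mult.commute)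
  have "q\<^sup>2 \<le> q" using q by (simp add: power2_eq_square mult_left_le)
  then have "q\<^sup>2 / 4 * p \<le> q / 4 * p" using p by (intro mult_right_mono) auto
  then have rq': "r \<le> q / 4 * p" using rq by linarith
  have \<tau>q: "\<tau> = q * (\<kappa> - 1) / \<kappa>" using \<kappa> by (simp add: q_def)
  have v: "1 \<le> v" "v \<le> \<kappa>" using q \<kappa> mult_right_mono[of "3 / 4 * q" 1 "\<kappa> - 1"] by (auto simp: v_def)
  \<comment> \<open>The claimed drop is equivalent to \<open>|P - r x| \<le> A\<close>, which is proved by comparing squares.\<close>
  define A where "A = p - r * v / \<kappa>"
  have "r * v / \<kappa> \<le> r" using v \<kappa> r(1) by (simp add: divide_le_eq mult_left_mono)
  moreover have "q / 4 * p \<le> p" using q p by simp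
  ultimately have A0: "0 \<le> A" using rq' unfolding A_def by linarith
  have "(norm (P - r *\<^sub>R x))\<^sup>2 = p\<^sup>2 - 2 * r * (x \<bullet> P) + r\<^sup>2"
    unfolding p_def by (rule norm_diff_ray_sq[OF x])
  also have "\<dots> \<le> p\<^sup>2 - 2 * r * ((1 / \<kappa> + \<tau>) * p) + r\<^sup>2"
    using mult_left_mono[OF angle, of "2 * r"] r(1) by (simp add: p_def)
  also have "\<dots> \<le> A\<^sup>2"
  proof -
    have "r * ((\<kappa>\<^sup>2 - 1) / \<kappa>\<^sup>2) \<le> q / 4 * p * (2 * (\<kappa> - 1) / \<kappa>)"
    proof (rule mult_mono[OF rq'])
      have "(\<kappa>\<^sup>2 - 1) / \<kappa>\<^sup>2 = (\<kappa> - 1) / \<kappa> * (1 + 1 / \<kappa>)" using \<kappa> by (simp add: field_simps power2_eq_square)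
      also have "\<dots> \<le> (\<kappa> - 1) / \<kappa> * 2" using \<kappa> by (intro mult_left_mono) auto
      also have "\<dots> = 2 * (\<kappa> - 1) / \<kappa>" by simp
      finally show "(\<kappa>\<^sup>2 - 1) / \<kappa>\<^sup>2 \<le> 2 * (\<kappa> - 1) / \<kappa>" .
    qed (use q p \<kappa> in auto)
    then have "r * (r * ((\<kappa>\<^sup>2 - 1) / \<kappa>\<^sup>2)) \<le> r * (q / 4 * p * (2 * (\<kappa> - 1) / \<kappa>))"
      using r(1) by (rule mult_left_mono)
    moreover have "r\<^sup>2 * (1 / \<kappa>\<^sup>2) \<le> r\<^sup>2 * (v\<^sup>2 / \<kappa>\<^sup>2)"
      using v by (intro mult_left_mono divide_right_mono) auto
    moreover have "A\<^sup>2 - (p\<^sup>2 - 2 * r * ((1 / \<kappa> + \<tau>) * p) + r\<^sup>2)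
      = r * (q / 4 * p * (2 * (\<kappa> - 1) / \<kappa>)) - r\<^sup>2 + r\<^sup>2 * (v\<^sup>2 / \<kappa>\<^sup>2)"
      unfolding A_def \<tau>q v_def using \<kappa> by (simp add: power2_eq_square field_simps)
    moreover have "r * (r * ((\<kappa>\<^sup>2 - 1) / \<kappa>\<^sup>2)) = r\<^sup>2 - r\<^sup>2 * (1 / \<kappa>\<^sup>2)"
      using \<kappa> by (simp add: power2_eq_square field_simps)
    ultimately show ?thesis by linarith
  qed
  finally have "norm (P - r *\<^sub>R x) \<le> A" using A0 by (rule power2_le_imp_le)
  then have "\<kappa> * norm (P - r *\<^sub>R x) \<le> \<kappa> * A" using \<kappa> by simp
  also have "\<kappa> * A = \<kappa> * p - r - (\<kappa> - 1) * (3 / 4 * q * r)"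
    unfolding A_def v_def using \<kappa> by (simp add: field_simps)
  also have "\<dots> \<le> \<kappa> * p - r - (\<kappa> - 1) * norm X"
    using mult_left_mono[OF X, of "\<kappa> - 1"] \<kappa> by (simp add: q_def)
  finally have "optical_path \<kappa> P (r *\<^sub>R x) \<le> norm X + \<kappa> * (norm P - norm X)"
    using x r(1) by (simp add: optical_path_def p_def algebra_simps)
  also have "\<dots> \<le> optical_path \<kappa> P X"
    unfolding optical_path_def using norm_triangle_ineq2[of P X] \<kappa> by simp
  finally show ?thesis .
qed

lemma uniform_steepness:
  fixes K D :: "'a::euclidean_space set"
  assumes K: "compact K" "K \<noteq> {}" and D: "compact D" "D \<noteq> {}" and r0: "0 < r0"
    and off: "\<And>x P t. \<lbrakk>x \<in> K; P \<in> D; 0 \<le> t; t \<le> r0\<rbrakk> \<Longrightarrow> P \<noteq> t *\<^sub>R x"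
    and steep: "\<And>x P t. \<lbrakk>x \<in> K; P \<in> D; 0 \<le> t; t \<le> r0\<rbrakk> \<Longrightarrow> norm (P - t *\<^sub>R x) < \<kappa> * (x \<bullet> P - t)"
  shows "\<exists>\<delta>>0. \<forall>x\<in>K. \<forall>P\<in>D. \<forall>t\<in>{0..r0}. (1 + \<delta>) * norm (P - t *\<^sub>R x) \<le> \<kappa> * (x \<bullet> P - t)"
proof -
  define S where "S = K \<times> D \<times> {0..r0}"
  define h where "h s = \<kappa> * (fst s \<bullet> fst (snd s) - snd (snd s)) / norm (fst (snd s) - snd (snd s) *\<^sub>R fst s)"
    for s :: "'a \<times> 'a \<times> real"
  have "compact S" unfolding S_def by (intro compact_Times K D compact_Icc)
  moreover have "S \<noteq> {}" unfolding S_def using K D r0 by auto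
  moreover have "continuous_on S h" unfolding h_def
  proof (intro continuous_intros ballI)
    show "norm (fst (snd s) - snd (snd s) *\<^sub>R fst s) \<noteq> 0" if "s \<in> S" for s
      using that off unfolding S_def by auto
  qed
  ultimately obtain s where s: "s \<in> S" "\<And>s'. s' \<in> S \<Longrightarrow> h s \<le> h s'"
    using continuous_attains_inf by metis
  have ok: "norm (P - t *\<^sub>R x) > 0 \<and> norm (P - t *\<^sub>R x) < \<kappa> * (x \<bullet> P - t)"
    if "x \<in> K" "P \<in> D" "t \<in> {0..r0}" for x P t
    using off[of x P t] steep[of x P t] that by auto
  have "1 < h s" using ok s(1) unfolding S_def h_def by auto
  moreover have "(1 + (h s - 1)) * norm (P - t *\<^sub>R x) \<le> \<kappa> * (x \<bullet> P - t)"
    if "x \<in> K" "P \<in> D" "t \<in> {0..r0}" for x P t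
  proof -
    have "h s \<le> h (x, P, t)" using s(2) that unfolding S_def by auto
    then show ?thesis using ok[OF that] unfolding h_def by (simp add: field_simps)
  qed
  ultimately show ?thesis by (intro exI[of _ "h s - 1"]) auto
qed

section \<open>Surface measure on the sphere\<close>

lemma measurable_direction:
  "(\<lambda>x::'a::euclidean_space. x /\<^sub>R norm x) \<in>
     restrict_space lborel (cball 0 1 - {0}) \<rightarrow>\<^sub>M restrict_space borel (sphere 0 1)"
  by (rule measurable_restrict_space3) (auto intro!: borel_measurable_scaleR)

lemma borel_sphere_measure:
  fixes S :: "'a::euclidean_space set"
  assumes "S \<in> sets borel" "S \<subseteq> sphere 0 1"
  shows "S \<in> sets sphere_measure"
  unfolding sphere_measure_def
  by (rule sets_completionI_sets) (use assms in \<open>simp add: sets_restrict_space_iff\<close>)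

lemma null_subset_sphere_measure:
  "A \<subseteq> B \<Longrightarrow> B \<in> null_sets sphere_measure \<Longrightarrow> A \<in> null_sets sphere_measure"
  unfolding sphere_measure_def by (rule completion.complete2)

lemma null_sphere_measure_if_negligible_cone:
  fixes S :: "'a::euclidean_space set"
  assumes S: "S \<in> sets borel" "S \<subseteq> sphere 0 1"
    and neg: "negligible {z. z \<noteq> 0 \<and> z /\<^sub>R norm z \<in> S}"
  shows "S \<in> null_sets sphere_measure"
proof -
  let ?R = "restrict_space lborel (cball (0::'a) 1 - {0})"
  let ?A = "(\<lambda>x. x /\<^sub>R norm x) -` S \<inter> space ?R"
  let ?d = "distr ?R (restrict_space borel (sphere 0 1)) (\<lambda>x. x /\<^sub>R norm x)"
  have Sr: "S \<in> sets (restrict_space borel (sphere 0 1))"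
    using S by (simp add: sets_restrict_space_iff)
  have A: "?A \<in> sets ?R" by (rule measurable_sets[OF measurable_direction Sr])
  have C: "cball (0::'a) 1 - {0} \<in> sets lborel" by simp
  have Al: "?A \<in> sets lborel" using A C sets_restrict_space_iff[of "cball 0 1 - {0}" lborel ?A] by simp
  have "?A \<subseteq> {z. z \<noteq> 0 \<and> z /\<^sub>R norm z \<in> S}" by (auto simp: space_restrict_space)
  then have "negligible ?A" using neg negligible_subset by blast
  then have "emeasure lborel ?A = 0"
    using Al by (simp add: negligible_iff_null_sets null_sets_def)
  then have "emeasure ?R ?A = 0"
    using C by (subst emeasure_restrict_space) (auto simp: space_restrict_space)
  then have "emeasure ?d S = 0" by (subst emeasure_distr[OF measurable_direction Sr])
  then show ?thesis unfolding sphere_measure_def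
    by (intro null_sets_completionI) (use Sr in \<open>simp add: null_sets_def\<close>)
qed

text \<open>The function \<open>f\<close> is known to be measurable on \<open>\<Omega>\<close> only. Completeness of the measure makes its
  arbitrary values on the null set \<open>E - \<Omega>\<close> harmless.\<close>

lemma integral_density_restrict:
  fixes f :: "'a::euclidean_space \<Rightarrow> real" and \<sigma> :: "'a measure"
  assumes complete: "\<And>A B. A \<subseteq> B \<Longrightarrow> B \<in> null_sets \<sigma> \<Longrightarrow> A \<in> null_sets \<sigma>"
    and f: "set_integrable \<sigma> \<Omega> f" "AE x\<in>\<Omega> in \<sigma>. 0 < f x" and \<Omega>: "\<Omega> \<in> sets \<sigma>"
    and E: "E \<in> sets \<sigma>" "E - \<Omega> \<in> null_sets \<sigma>"
  shows "emeasure (density \<sigma> (\<lambda>x. ennreal (indicator \<Omega> x * f x))) E = ennreal (LINT x:E|\<sigma>. f x)"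
proof -
  define g where "g x = indicator \<Omega> x * f x" for x
  have g: "integrable \<sigma> g" using f(1) unfolding set_integrable_def g_def by simp
  have g0: "AE x in \<sigma>. 0 \<le> g x" using f(2) unfolding g_def by eventually_elim (auto simp: indicator_def)
  have gE: "integrable \<sigma> (\<lambda>x. indicator E x * g x)" using integrable_mult_indicator[OF E(1) g] by simp
  have notin: "AE x in \<sigma>. x \<notin> E - \<Omega>" by (rule AE_not_in[OF E(2)])
  have meas: "(\<lambda>x. indicator E x * f x) \<in> borel_measurable \<sigma>"
  proof (rule measurableI)
    fix B :: "real set" assume B: "B \<in> sets borel"
    let ?Z = "E - \<Omega>"
    have eq: "(\<lambda>x. indicator E x * f x) -` B \<inter> space \<sigma> =
      (((\<lambda>x. indicator E x * g x) -` B \<inter> space \<sigma>) - ?Z) \<union> ((\<lambda>x. indicator E x * f x) -` B \<inter> space \<sigma> \<inter> ?Z)"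
      by (auto simp: g_def indicator_def split: if_splits)
    have "(\<lambda>x. indicator E x * f x) -` B \<inter> space \<sigma> \<inter> ?Z \<in> sets \<sigma>"
      using complete[OF _ E(2)] by (meson Int_lower2 null_setsD2)
    moreover have "(\<lambda>x. indicator E x * g x) -` B \<inter> space \<sigma> \<in> sets \<sigma>"
      using gE B by (intro measurable_sets[where A = borel]) auto
    ultimately have "(((\<lambda>x. indicator E x * g x) -` B \<inter> space \<sigma>) - ?Z) \<union>
        ((\<lambda>x. indicator E x * f x) -` B \<inter> space \<sigma> \<inter> ?Z) \<in> sets \<sigma>"
      using E \<Omega> by (intro sets.Un sets.Diff) auto
    then show "(\<lambda>x. indicator E x * f x) -` B \<inter> space \<sigma> \<in> sets \<sigma>"
      unfolding eq[symmetric] .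
  qed simp
  have "emeasure (density \<sigma> (\<lambda>x. ennreal (g x))) E = (\<integral>\<^sup>+x. ennreal (g x) * indicator E x \<partial>\<sigma>)"
    using g E(1) by (intro emeasure_density) auto
  also have "\<dots> = (\<integral>\<^sup>+x. ennreal (indicator E x * g x) \<partial>\<sigma>)"
    by (intro nn_integral_cong) (auto simp: indicator_def)
  also have "\<dots> = ennreal (\<integral>x. indicator E x * g x \<partial>\<sigma>)"
    by (rule nn_integral_eq_integral[OF gE]) (use g0 in eventually_elim, auto simp: indicator_def)
  also have "(\<integral>x. indicator E x * g x \<partial>\<sigma>) = (\<integral>x. indicator E x * f x \<partial>\<sigma>)"
  proof (rule integral_cong_AE)
    show "AE x in \<sigma>. indicator E x * g x = indicator E x * f x"
      using notin by eventually_elim (auto simp: g_def indicator_def)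
  qed (use gE meas in auto)
  finally show ?thesis unfolding set_lebesgue_integral_def g_def by simp
qed

section \<open>Existence of weak solutions\<close>

theorem theorem6p9:
  fixes \<kappa> \<tau> r0 :: real
    and \<Omega> D :: "(real ^ 'n) set"
    and \<mu> :: "(real ^ 'n) measure"
    and f :: "real ^ 'n \<Rightarrow> real"
    and X0 :: "real ^ 'n"
  assumes dim: "CARD('n) \<ge> 2"
    and kappa: "\<kappa> > 1"
    and Omega_domain: "openin (top_of_set (sphere 0 1)) \<Omega>" "connected \<Omega>" "\<Omega> \<noteq> {}"
    and Omega_boundary:
      "emeasure sphere_measure (top_of_set (sphere 0 1) frontier_of \<Omega>) = 0"
    and D: "compact D" "hypersurface D" "0 \<notin> closure D"
    and tau: "0 < \<tau>" "\<tau> < 1 - 1 / \<kappa>"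
    and H3: "(INF (x, P) \<in> closure \<Omega> \<times> closure D. x \<bullet> (P /\<^sub>R norm P)) \<ge> 1 / \<kappa> + \<tau>"
    and r0: "0 < r0" "r0 < \<kappa>\<^sup>2 * \<tau>\<^sup>2 / (4 * (\<kappa> - 1)\<^sup>2) * (INF P\<in>D. norm P)"
    and H4: "\<And>m X P P'. \<lbrakk>m \<in> sphere 0 1; X \<in> source_cone \<Omega> r0;
               P \<in> closure D \<inter> {X + t *\<^sub>R m | t. t \<ge> 0};
               P' \<in> closure D \<inter> {X + t *\<^sub>R m | t. t \<ge> 0}\<rbrakk> \<Longrightarrow> P = P'"
    and mu: "radon_measure_on (closure D) \<mu>"
    and f: "set_integrable sphere_measure \<Omega> f" "AE x\<in>\<Omega> in sphere_measure. f x > 0"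
    and energy: "ennreal (LINT x:\<Omega>|sphere_measure. f x) = emeasure \<mu> (closure D)"
    and X0: "X0 \<in> source_cone \<Omega> r0" "0 < norm X0"
      "norm X0 < r0 ^ 4 / (8 * (SUP P\<in>D. norm P) ^ 3)"
  shows "\<exists>\<rho>. weak_solution \<kappa> \<Omega> D r0 f \<mu> \<rho> \<and> X0 \<in> radial_surface \<Omega> \<rho>"
proof -
  define K where "K = closure \<Omega>"
  \<comment> \<open>With \<open>q\<close> as below, \<open>C = q\<^sup>2 / 4\<close>, and the bound on \<open>r0\<close> becomes \<open>r0 < C |P|\<close> for all targets.\<close>
  define C where "C = \<kappa>\<^sup>2 * \<tau>\<^sup>2 / (4 * (\<kappa> - 1)\<^sup>2)"
  define q where "q = \<kappa> * \<tau> / (\<kappa> - 1)"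
  have clD: "closure D = D" using D(1) by (simp add: compact_imp_closed)
  have D0: "D \<noteq> {}" using D(2) unfolding hypersurface_def by blast
  have P0: "P \<noteq> 0" if "P \<in> D" for P using that D(3) clD by auto
  have \<Omega>s: "\<Omega> \<subseteq> sphere 0 1" using Omega_domain(1) openin_imp_subset by blast
  have Ks: "K \<subseteq> sphere 0 1" unfolding K_def by (rule closure_minimal[OF \<Omega>s]) simp
  have Kc: "compact K"
    unfolding K_def using \<Omega>s bounded_subset[OF bounded_sphere] by (simp add: compact_closure)
  have \<Omega>K: "\<Omega> \<subseteq> K" unfolding K_def by (rule closure_subset)
  have K0: "K \<noteq> {}" using Omega_domain(3) \<Omega>K by blast
  have q: "0 < q" "q < 1" using kappa tau by (auto simp: q_def field_simps)
  have Cq: "C = q\<^sup>2 / 4" by (simp add: C_def q_def power_divide power_mult_distrib)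
  have C1: "0 \<le> C" "C \<le> q / 4" "C < 1" unfolding Cq using q
    by (auto simp: power2_eq_square mult_left_le) (smt (verit) mult_left_le)

  have angle: "(1 / \<kappa> + \<tau>) * norm P \<le> x \<bullet> P" if xP: "x \<in> K" "P \<in> D" for x P
  proof -
    have "bdd_below ((\<lambda>(x, P). x \<bullet> (P /\<^sub>R norm P)) ` (K \<times> D))"
    proof (rule bdd_belowI[of _ "- 1"])
      fix v assume "v \<in> (\<lambda>(x, P). x \<bullet> (P /\<^sub>R norm P)) ` (K \<times> D)"
      then obtain x P where v: "v = x \<bullet> (P /\<^sub>R norm P)" "x \<in> K" "P \<in> D" by auto
      have "\<bar>v\<bar> \<le> norm x * norm (P /\<^sub>R norm P)" unfolding v(1) by (rule Cauchy_Schwarz_ineq2)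
      also have "\<dots> = 1" using v Ks P0 by auto
      finally show "- 1 \<le> v" by simp
    qed
    then have "(INF (x, P) \<in> K \<times> D. x \<bullet> (P /\<^sub>R norm P)) \<le> x \<bullet> (P /\<^sub>R norm P)"
      using cINF_lower[of "\<lambda>(x, P). x \<bullet> (P /\<^sub>R norm P)" "K \<times> D" "(x, P)"] xP by simp
    then have "1 / \<kappa> + \<tau> \<le> (x \<bullet> P) / norm P"
      using H3 unfolding clD K_def[symmetric] by (simp add: divide_inverse mult.commute)
    then show ?thesis using P0[OF xP(2)] by (simp add: le_divide_eq)
  qed
  have r0P: "r0 < C * norm P" if "P \<in> D" for P
  proof -
    have "bdd_below (norm ` D)" by (rule bdd_belowI[of _ 0]) auto
    then have "(INF P\<in>D. norm P) \<le> norm P" using that by (intro cINF_lower)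
    then have "C * (INF P\<in>D. norm P) \<le> C * norm P" using C1 by (intro mult_left_mono)
    then show ?thesis using r0(2) unfolding C_def by linarith
  qed
  have far: "r0 < norm P" if "P \<in> D" for P
  proof -
    have "C * norm P \<le> norm P" using C1 by (simp add: mult_left_le_one_le)
    then show ?thesis using r0P[OF that] by linarith
  qed
  have steep0: "norm (P - t *\<^sub>R x) < \<kappa> * (x \<bullet> P - t)" if "x \<in> K" "P \<in> D" "0 \<le> t" "t \<le> r0" for x P t
    using that r0P[OF that(2)] Ks unfolding C_def
    by (intro steep_of_angle[OF kappa tau _ P0[OF that(2)] angle]) auto
  have off: "P \<noteq> t *\<^sub>R x" if "x \<in> K" "P \<in> D" "0 \<le> t" "t \<le> r0" for x P t
    using far[OF that(2)] that Ks by auto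
  obtain \<delta> where \<delta>: "0 < \<delta>"
    and steep: "\<And>x P t. \<lbrakk>x \<in> K; P \<in> D; 0 \<le> t; t \<le> r0\<rbrakk> \<Longrightarrow> (1 + \<delta>) * norm (P - t *\<^sub>R x) \<le> \<kappa> * (x \<bullet> P - t)"
    using uniform_steepness[OF Kc K0 D(1) D0 r0(1) off steep0] by auto

  \<comment> \<open>As \<open>r0 / R \<le> q / 4 < 1\<close>, the quantity \<open>r0\<^sup>4 / (8 R\<^sup>3)\<close> is below \<open>q r0\<close> by a wide margin.\<close>
  define R where "R = (SUP P\<in>D. norm P)"
  have XR: "norm X0 \<le> 3 / 4 * (\<kappa> * \<tau> / (\<kappa> - 1)) * r0"
  proof -
    obtain P where P: "P \<in> D" using D0 by blast
    have "bdd_above (norm ` D)"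
      using compact_imp_bounded[OF D(1)] by (auto simp: bounded_iff bdd_above_def)
    then have PR: "norm P \<le> R" unfolding R_def using P by (rule cSUP_upper[rotated])
    have R0: "R > 0" using P0[OF P] PR by (smt (verit) zero_less_norm_iff)
    have "C * norm P \<le> q / 4 * R" using C1 PR q by (intro mult_mono) auto
    then have "r0 \<le> q / 4 * R" using r0P[OF P] by linarith
    then have rR: "r0 / R \<le> q / 4" using R0 by (simp add: divide_le_eq)
    define s where "s = r0 / R"
    have "0 \<le> s" "s \<le> q / 4" using rR r0(1) R0 by (auto simp only: s_def intro!: divide_nonneg_pos)
    then have s: "0 \<le> s" "s \<le> 1" "s \<le> q / 4" using q by simp_all
    have "s ^ 3 \<le> s" using s power_decreasing[of 1 3 s] by simp
    have "norm X0 < r0 ^ 4 / (8 * R ^ 3)" using X0(3) unfolding R_def .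
    also have "\<dots> = r0 * (s ^ 3 / 8)" using R0 by (simp add: s_def power_divide power_numeral_reduce)
    also have "\<dots> \<le> r0 * (3 / 4 * q)"
      using \<open>s ^ 3 \<le> s\<close> s q r0(1) by (intro mult_left_mono) auto
    also have "\<dots> = 3 / 4 * q * r0" by simp
    finally show ?thesis unfolding q_def by (rule less_imp_le)
  qed
  obtain t0 z where z: "X0 = t0 *\<^sub>R z" "z \<in> K" "0 < t0" "t0 \<le> r0"
    using X0(1) unfolding source_cone_def K_def by auto

  interpret anchored_refraction \<kappa> \<delta> r0 K D z t0
  proof unfold_locales
    fix x m P P' s s' t
    assume *: "x \<in> K" "0 < t" "t \<le> r0" "norm m = 1" "P \<in> D" "P' \<in> D" "0 \<le> s" "0 \<le> s'"
      "P = t *\<^sub>R x + s *\<^sub>R m" "P' = t *\<^sub>R x + s' *\<^sub>R m"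
    show "P = P'"
    proof (rule H4)
      show "m \<in> sphere 0 1" using *(4) by simp
      show "t *\<^sub>R x \<in> source_cone \<Omega> r0" using *(1-3) unfolding source_cone_def K_def by blast
    qed (use * clD in auto)
  next
    fix x P assume xP: "x \<in> K" "P \<in> D"
    show "optical_path \<kappa> P (r0 *\<^sub>R x) \<le> optical_path \<kappa> P (t0 *\<^sub>R z)"
      unfolding z(1)[symmetric]
      using r0P[OF xP(2)] r0(1) xP Ks unfolding C_def
      by (intro optical_path_at_far_end[OF kappa tau _ P0[OF xP(2)] angle[OF xP] _ _ XR]) auto
  qed (use kappa \<delta> r0 Kc Ks D D0 far steep z in auto)

  \<comment> \<open>The density vanishes off \<open>\<Omega>\<close>, so that values of \<open>f\<close> on the boundary do not enter.\<close>
  define M where "M = density sphere_measure (\<lambda>x. ennreal (indicator \<Omega> x * f x))"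
  have \<Omega>b: "\<Omega> \<in> sets borel"
  proof -
    obtain T where "open T" "\<Omega> = sphere 0 1 \<inter> T" using Omega_domain(1) unfolding openin_open by blast
    then show ?thesis by auto
  qed
  have \<Omega>\<sigma>: "\<Omega> \<in> sets sphere_measure" by (rule borel_sphere_measure[OF \<Omega>b \<Omega>s])
  have Kb: "K \<in> sets borel" using Kc by (rule borel_compact)
  have frontier: "top_of_set (sphere 0 1) frontier_of \<Omega> = K - \<Omega>"
  proof -
    have "top_of_set (sphere 0 1) closure_of \<Omega> = K"
      using \<Omega>s Ks by (simp add: closure_of_subtopology K_def Int_absorb1)
    then show ?thesis using interior_of_openin[OF Omega_domain(1)] unfolding frontier_of_def by simp
  qed
  have KO: "K - \<Omega> \<in> null_sets sphere_measure"
    using Omega_boundary borel_sphere_measure[of "K - \<Omega>"] Kb \<Omega>b Ks unfolding frontier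
    by (auto simp: null_sets_def)
  have ME: "emeasure M E = ennreal (LINT x:E|sphere_measure. f x)"
    if E: "E \<in> sets sphere_measure" "E \<subseteq> K" for E
    unfolding M_def
  proof (rule integral_density_restrict[OF _ f \<Omega>\<sigma> E(1)])
    show "A \<in> null_sets sphere_measure" if "A \<subseteq> B" "B \<in> null_sets sphere_measure"
      for A B :: "(real ^ 'n) set" using that by (rule null_subset_sphere_measure)
    show "E - \<Omega> \<in> null_sets sphere_measure"
      using E(2) by (intro null_subset_sphere_measure[OF _ KO]) auto
  qed
  have meas_g: "(\<lambda>x. ennreal (indicator \<Omega> x * f x)) \<in> borel_measurable sphere_measure"
    using f(1) unfolding set_integrable_def by (auto simp: real_scaleR_def)
  have M_null: "A \<in> null_sets M" if "A \<in> null_sets sphere_measure" for A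
    unfolding M_def using absolutely_continuousI_density[OF meas_g] that
    unfolding absolutely_continuous_def by blast
  have M_\<Omega>: "emeasure M (space M - \<Omega>) = 0"
  proof -
    have "emeasure M (space M - \<Omega>) =
        (\<integral>\<^sup>+x. ennreal (indicator \<Omega> x * f x) * indicator (space M - \<Omega>) x \<partial>sphere_measure)"
      unfolding M_def space_density
      by (rule emeasure_density[OF meas_g sets.compl_sets[OF \<Omega>\<sigma>]])
    also have "\<dots> = (\<integral>\<^sup>+x. 0 \<partial>(sphere_measure :: (real ^ 'n) measure))"
      by (intro nn_integral_cong) (auto simp: indicator_def)
    finally show ?thesis by simp
  qed
  have \<Omega>M: "\<Omega> \<in> sets M" using \<Omega>\<sigma> by (simp add: M_def)
  have M_ae: "emeasure M E = emeasure M \<Omega>" if E: "E \<in> sets M" "\<Omega> \<subseteq> E" for E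
  proof -
    have "emeasure M (E - \<Omega>) \<le> emeasure M (space M - \<Omega>)"
      using E \<Omega>M sets.sets_into_space[OF E(1)] by (intro emeasure_mono) auto
    then have "emeasure M (E - \<Omega>) = 0" using M_\<Omega> by simp
    then have "E - \<Omega> \<in> null_sets M" using E \<Omega>M by (intro null_setsI) auto
    then show ?thesis using emeasure_Un_null_set[OF \<Omega>M] E(2) by (metis Un_Diff_cancel Un_absorb1)
  qed
  have M\<Omega>: "emeasure M \<Omega> = ennreal (LINT x:\<Omega>|sphere_measure. f x)" by (rule ME[OF \<Omega>\<sigma> \<Omega>K])
  interpret emitting_refraction \<kappa> \<delta> r0 K D z t0 M
  proof (intro emitting_refraction.intro anchored_refraction_axioms emitting_refraction_axioms.intro finite_measureI)
    show "emeasure M (space M) \<noteq> \<infinity>"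
      using M_ae[of "space M"] sets.sets_into_space[OF \<Omega>M] M\<Omega> by simp
    show "S \<in> sets M" if "S \<in> sets borel" "S \<subseteq> K" for S
      using borel_sphere_measure[of S] that Ks by (auto simp: M_def)
    fix \<rho> S assume R: "visible_refractor \<kappa> \<delta> r0 K D \<rho>" and S: "S \<subseteq> refractor.ambiguous \<kappa> K D \<rho>"
    interpret R: visible_refractor \<kappa> \<delta> r0 K D \<rho> by (rule R)
    have aK: "R.ambiguous \<subseteq> K" unfolding R.ambiguous_def by auto
    have "R.ambiguous \<inter> \<Omega> \<in> null_sets sphere_measure"
      using R.ambiguous_borel \<Omega>b \<Omega>s
      by (intro null_sphere_measure_if_negligible_cone
          R.negligible_ambiguous_cone[OF Omega_domain(1) \<Omega>K]) auto
    then have "(R.ambiguous \<inter> \<Omega>) \<union> (K - \<Omega>) \<in> null_sets sphere_measure" using KO by (rule null_sets.Un)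
    moreover have "S \<subseteq> (R.ambiguous \<inter> \<Omega>) \<union> (K - \<Omega>)" using S aK by auto
    ultimately show "S \<in> null_sets M" by (intro M_null) (rule null_subset_sphere_measure)
  qed

  have mu_sets: "sets \<mu> = sets (restrict_space borel D)"
    and mu_fin: "\<And>C. compact C \<Longrightarrow> C \<subseteq> D \<Longrightarrow> emeasure \<mu> C < \<infinity>"
    and mu_inner: "\<And>B. B \<in> sets \<mu> \<Longrightarrow> emeasure \<mu> B = (SUP C\<in>{C. compact C \<and> C \<subseteq> B}. emeasure \<mu> C)"
    using mu unfolding radon_measure_on_def clD by auto
  have space_mu: "space \<mu> = D"
    using sets_eq_imp_space_eq[OF mu_sets] by (simp add: space_restrict_space)
  have fin_mu: "finite_measure \<mu>"
    using mu_fin[OF D(1) order_refl] by (intro finite_measureI) (simp add: space_mu)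
  have KM: "emeasure M K = emeasure \<mu> D"
  proof -
    have "emeasure M K = emeasure M \<Omega>" by (rule M_ae[OF borel_sets[OF Kb order_refl] \<Omega>K])
    then show ?thesis using energy M\<Omega> by (simp add: clD)
  qed
  then have "measure \<mu> D = measure M K" by (simp add: measure_def)
  from weak_refractor_exists[OF fin_mu mu_sets this mu_inner]
  obtain \<rho> where R: "visible_refractor \<kappa> \<delta> r0 K D \<rho>" and \<rho>z: "\<rho> z = t0"
    and sol: "\<And>B. B \<in> sets borel \<Longrightarrow> B \<subseteq> D \<Longrightarrow> emeasure \<mu> B = emeasure M (refractor.preimage \<kappa> K D \<rho> B)"
    by auto
  interpret R: visible_refractor \<kappa> \<delta> r0 K D \<rho> by (rule R)
  have supports: "(\<exists>b. oval_supports \<kappa> \<Omega> \<rho> P b y) \<longleftrightarrow> touches \<kappa> K \<rho> P y" if "y \<in> K" "P \<in> D" for y P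
  proof (rule oval_supports_iff_touches[OF _ K_def anchor(1) _ that])
    show "0 < \<rho> x \<and> \<rho> x \<le> r0" if "x \<in> closure \<Omega>" for x using R.radius that unfolding K_def .
    show "optical_path \<kappa> P (r0 *\<^sub>R x) \<le> optical_path \<kappa> P (\<rho> z *\<^sub>R z)" if "x \<in> K" "P \<in> D" for x P
      unfolding \<rho>z by (rule anchor_low[OF that])
  qed
  have pre: "refractor_preimage \<kappa> \<Omega> D \<rho> F = R.preimage F" for F
    unfolding refractor_preimage_def refractor_map_def R.preimage_def clD K_def[symmetric]
    using supports by blast
  have "near_field_refractor \<kappa> \<Omega> D r0 \<rho>"
    unfolding near_field_refractor_def
  proof (intro conjI ballI)
    show "0 < \<rho> x" if "x \<in> closure \<Omega>" for x using R.radius that unfolding K_def by blast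
    show "radial_surface \<Omega> \<rho> \<subseteq> source_cone \<Omega> r0"
      using R.radius unfolding radial_surface_def source_cone_def K_def by blast
    show "\<exists>P\<in>closure D. \<exists>b. oval_supports \<kappa> \<Omega> \<rho> P b y" if "y \<in> closure \<Omega>" for y
      using R.touched[of y] supports[of y] that unfolding clD K_def by blast
  qed
  moreover have "refractor_preimage \<kappa> \<Omega> D \<rho> F \<in> sets sphere_measure \<and>
      ennreal (refractor_measure \<kappa> \<Omega> D \<rho> f F) = emeasure \<mu> F"
    if F: "F \<in> sets borel" "F \<subseteq> closure D" for F
  proof -
    have s: "R.preimage F \<in> sets sphere_measure"
      using preimage_sets[OF R F(1)] by (simp add: M_def)
    have "R.preimage F \<subseteq> K" unfolding R.preimage_def by auto
    then have "emeasure M (R.preimage F) = ennreal (refractor_measure \<kappa> \<Omega> D \<rho> f F)"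
      unfolding refractor_measure_def pre by (rule ME[OF s])
    then show ?thesis using s sol[OF F(1)] F(2) by (simp add: pre clD)
  qed
  ultimately have "weak_solution \<kappa> \<Omega> D r0 f \<mu> \<rho>" unfolding weak_solution_def by blast
  moreover have "X0 \<in> radial_surface \<Omega> \<rho>"
    unfolding radial_surface_def z(1) using \<rho>z z(2) unfolding K_def by blast
  ultimately show ?thesis by blast
qed

end
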